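(* Fix $\rho>0$ and a set $\mathcal X\subseteq\mathbb S_{++}^p$ of admissible precision matrices. For any $\widehat\mu\in\mathbb R^p$ and $\widehat\Sigma\in\mathbb S_+^p$, the general distributionally robust estimation problem $$\mathcal J(\widehat\mu,\widehat\Sigma):=\inf_{\mu\in\mathbb R^p,\,X\in\mathcal X}\Big\{-\log\det X+\sup_{\mathbb Q\in\mathcal P_\rho}\mathbb E^{\mathbb Q}\big[(\xi-\mu)^\top X(\xi-\mu)\big]\Big\}$$ is equivalent to the optimization problem $$\inf_{X,\gamma}\Big\{-\log\det X+\gamma\big(\rho^2-\mathrm{Tr}[\widehat\Sigma]\big)+\gamma^2\big\langle(\gamma I-X)^{-1},\widehat\Sigma\big\rangle\;:\;\gamma I\succ X\succ0,\;X\in\mathcal X\Big\}$$ and to the semidefinite program $$\inf_{X,Y,\gamma}\left\{-\log\det X+\gamma\big(\rho^2-\mathrm{Tr}[\widehat\Sigma]\big)+\mathrm{Tr}[Y]\;:\;\begin{bmatrix}Y&\gamma\widehat\Sigma^{1/2}\\ \gamma\widehat\Sigma^{1/2}&\gamma I-X\end{bmatrix}\succeq0,\;\gamma I\succ X\succ0,\;Y\succeq0,\;X\in\mathcal X\right\},$$ that is, $\mathcal J(\widehat\mu,\widehat\Sigma)$ equals the optimal value of each of these two problems. Moreover, the optimal value function $\mathcal J(\widehat\mu,\widehat\Sigma)$ is constant in $\widehat\mu\in\mathbb R^p$ and continuous in $\widehat\Sigma\in\mathbb S_+^p$.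
   Context: $\mathbb S^p$ is the space of symmetric real $p\times p$ matrices, $\mathbb S_+^p$ ($\mathbb S_{++}^p$) the cone of positive semidefinite (positive definite) ones; $A\succeq B$ ($A\succ B$) means $A-B\in\mathbb S_+^p$ ($A-B\in\mathbb S_{++}^p$), and analogously for other dimensions; $\langle A,B\rangle=\mathrm{Tr}[A^\top B]$. The decision variables are $\gamma\in\mathbb R$ and $X,Y\in\mathbb S^p$; the infimum over an empty set is $+\infty$. $\mathcal N(\mu,\Sigma)$ denotes the (possibly degenerate) normal distribution on $\mathbb R^p$ with mean $\mu$ and covariance matrix $\Sigma\in\mathbb S_+^p$, and $\mathcal N^p$ is the family of all such normal distributions. The type-2 Wasserstein distance between distributions $\mathbb P_1,\mathbb P_2$ on $\mathbb R^p$ with finite second moments is $\mathbb W(\mathbb P_1,\mathbb P_2)=\inf_\Pi\big(\int\|\xi_1-\xi_2\|^2\,\Pi(d\xi_1,d\xi_2)\big)^{1/2}$, where $\Pi$ ranges over all joint distributions with marginals $\mathbb P_1$ and $\mathbb P_2$ and $\|\cdot\|$ is the Euclidean norm. The ambiguity set is $\mathcal P_\rho=\{\mathbb Q\in\mathcal N^p:\mathbb W(\mathcal N(\widehat\mu,\widehat\Sigma),\mathbb Q)\le\rho\}$. Under $\mathbb E^{\mathbb Q}$, the random vector $\xi\in\mathbb R^p$ has distribution $\mathbb Q$. *)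

theory Defs
  imports "HOL-Probability.Probability"
begin

definition psd :: "real^'n^'n \<Rightarrow> bool" where
  "psd A \<longleftrightarrow> transpose A = A \<and> (\<forall>x. 0 \<le> x \<bullet> (A *v x))"

definition pos_def :: "real^'n^'n \<Rightarrow> bool" where
  "pos_def A \<longleftrightarrow> transpose A = A \<and> (\<forall>x. x \<noteq> 0 \<longrightarrow> 0 < x \<bullet> (A *v x))"

definition loewner_ge :: "real^'n^'n \<Rightarrow> real^'n^'n \<Rightarrow> bool" (infix "\<succeq>" 50) where
  "A \<succeq> B \<longleftrightarrow> psd (A - B)"

definition loewner_gt :: "real^'n^'n \<Rightarrow> real^'n^'n \<Rightarrow> bool" (infix "\<succ>" 50) where
  "A \<succ> B \<longleftrightarrow> pos_def (A - B)"

definition trace_inner :: "real^'n^'n \<Rightarrow> real^'n^'n \<Rightarrow> real" where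
  "trace_inner A B = trace (transpose A ** B)"

text \<open>The unique positive semidefinite square root; only meaningful for positive
  semidefinite arguments.\<close>

definition psd_sqrt :: "real^'n^'n \<Rightarrow> real^'n^'n" where
  "psd_sqrt A = (THE B. psd B \<and> B ** B = A)"

definition block_matrix ::
  "real^'n^'n \<Rightarrow> real^'m^'n \<Rightarrow> real^'n^'m \<Rightarrow> real^'m^'m \<Rightarrow> real^('n + 'm)^('n + 'm)" where
  "block_matrix A B C D = (\<chi> i j.
     case i of
       Inl k \<Rightarrow> (case j of Inl l \<Rightarrow> A $ k $ l | Inr l \<Rightarrow> B $ k $ l)
     | Inr k \<Rightarrow> (case j of Inl l \<Rightarrow> C $ k $ l | Inr l \<Rightarrow> D $ k $ l))"

definition std_normal :: "(real^'n) measure" where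
  "std_normal = density lborel (\<lambda>z. ennreal (\<Prod>i\<in>UNIV. std_normal_density (z $ i)))"

text \<open>The law of \<open>\<mu> + psd_sqrt \<Sigma> *v z\<close> for standard normal \<open>z\<close>. Unlike a definition by a density, this
  covers the degenerate case of singular \<open>\<Sigma>\<close>.\<close>

definition normal :: "real^'n \<Rightarrow> real^'n^'n \<Rightarrow> (real^'n) measure" where
  "normal \<mu> \<Sigma> = distr std_normal borel (\<lambda>z. \<mu> + psd_sqrt \<Sigma> *v z)"

definition normal_family :: "(real^'n) measure set" where
  "normal_family = {normal \<mu> \<Sigma> | \<mu> \<Sigma>. psd \<Sigma>}"

definition couplings ::
  "(real^'n) measure \<Rightarrow> (real^'n) measure \<Rightarrow> ((real^'n) \<times> (real^'n)) measure set" where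
  "couplings P Q = {M. prob_space M \<and> sets M = sets borel \<and>
     distr M borel fst = P \<and> distr M borel snd = Q}"

text \<open>For Borel probability measures with finite second moments the integrand is integrable under
  every coupling and the product measure is a coupling, so the Bochner integral and the infimum
  over the reals are proper here. The definition is not meant for other measures.\<close>

definition wasserstein :: "(real^'n) measure \<Rightarrow> (real^'n) measure \<Rightarrow> real" where
  "wasserstein P Q =
     (INF M\<in>couplings P Q. sqrt (\<integral>\<xi>. (norm (fst \<xi> - snd \<xi>))\<^sup>2 \<partial>M))"

definition ambiguity_set :: "real \<Rightarrow> real^'n \<Rightarrow> real^'n^'n \<Rightarrow> (real^'n) measure set" where
  "ambiguity_set \<rho> \<mu>h \<Sigma>h = {Q \<in> normal_family. wasserstein (normal \<mu>h \<Sigma>h) Q \<le> \<rho>}"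

text \<open>Optimal values are extended reals, so that the infimum of an infeasible problem is \<open>\<infinity>\<close>.\<close>

definition dro_value ::
  "real \<Rightarrow> (real^'n^'n) set \<Rightarrow> real^'n \<Rightarrow> real^'n^'n \<Rightarrow> ereal" where
  "dro_value \<rho> \<X> \<mu>h \<Sigma>h =
     (INF (\<mu>, X) \<in> UNIV \<times> \<X>.
        ereal (- ln (det X)) +
        (SUP Q \<in> ambiguity_set \<rho> \<mu>h \<Sigma>h. ereal (\<integral>\<xi>. (\<xi> - \<mu>) \<bullet> (X *v (\<xi> - \<mu>)) \<partial>Q)))"

end

theory Submission
  imports Defs
begin

text \<open>Write \<open>A\<close> for the positive semidefinite square root of the covariance matrix, and use the
  Frobenius inner product on matrices. If \<open>z\<close> is standard normal, then \<open>\<mu> + A z\<close> has the nominal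
  law, and \<open>\<mu> + B z\<close> is a normal law at Wasserstein distance at most the Frobenius norm of \<open>A - B\<close>,
  under which the quadratic loss centred at \<open>\<mu>\<close> has expectation \<open>B \<bullet> (X ** B)\<close>. So the worst case is
  at least the maximum \<open>ball_max\<close> of this convex quadratic form over the ball of radius \<open>\<rho>\<close> around
  \<open>A\<close>, a trust-region problem in the space of matrices. Centring the loss elsewhere only adds a
  nonnegative term. That the law of \<open>\<mu> + B z\<close> is one of the given normal laws, which are built from
  positive semidefinite factors, follows for invertible \<open>B\<close> from the rotation invariance of the
  standard normal law, and invertible matrices are dense.

  In the other direction, fix a multiplier \<open>\<gamma>\<close> with \<open>mat \<gamma> - X\<close> positive definite. Completing the
  square bounds the loss at one end of a coupling by \<open>\<gamma>\<close> times the transport cost plus a quadratic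
  form at the nominal end, and integrating gives the objective \<open>dual_value\<close> of the first reformulation
  as an upper bound (\<open>ambiguity_weak_duality\<close>). There is no gap, because trust-region problems
  satisfy strong duality even though they maximize a convex function
  (\<open>trust_region_strong_duality\<close>): comparing a maximizer with its reflections inside the sphere yields
  the multiplier. Hence the value of the estimation problem is the infimum over \<open>X\<close> of
  \<open>- ln (det X) + ball_max \<rho> X A\<close>, which contains no mean (\<open>dro_value_eq_ball_max\<close>), and also the
  infimum of the dual objectives. Minimizing the trace of \<open>Y\<close> in the semidefinite program is a Schur
  complement computation.

  For continuity, scaling the ball shows that moving \<open>A\<close> changes \<open>ball_max \<rho> X A\<close> by at most a factor
  close to 1 that does not depend on \<open>X\<close> (\<open>ball_max_perturb\<close>). Since \<open>ln (det X)\<close> is at most half of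
  \<open>ball_max \<rho> X A\<close> up to a constant, the same kind of factor bounds the change of the infimum. It
  remains to compose with the square root, which is Hoelder continuous with exponent one half.\<close>

section \<open>Orthonormal eigenbases of symmetric matrices\<close>

lemma inner_matrix_vector_symmetric:
  fixes A :: "real^'n^'n"
  assumes "transpose A = A"
  shows "x \<bullet> (A *v y) = (A *v x) \<bullet> y"
  by (metis assms dot_lmul_matrix transpose_matrix_vector)

text \<open>A maximizer \<open>v\<close> of the quadratic form of \<open>A\<close> on the unit sphere of \<open>S\<close> is an eigenvector: with
  \<open>l\<close> the maximum, the form of \<open>l I - A\<close> is nonnegative on \<open>S\<close> and vanishes at \<open>v\<close>, so its gradient
  at \<open>v\<close> is orthogonal to \<open>S\<close>; that gradient lies in \<open>S\<close> by invariance.\<close>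

lemma invariant_subspace_has_eigenvector:
  fixes A :: "real^'n^'n"
  assumes sym: "transpose A = A" and S: "subspace S" and inv: "\<And>x. x \<in> S \<Longrightarrow> A *v x \<in> S"
    and ne: "S \<noteq> {0}"
  obtains v l where "v \<in> S" "norm v = 1" "A *v v = l *\<^sub>R v"
proof -
  define f where "f x = x \<bullet> (A *v x)" for x
  obtain s where s: "s \<in> S" "s \<noteq> 0" using ne S subspace_0 by blast
  have "compact (sphere 0 1 \<inter> S)"
    using S by (simp add: closed_subspace compact_Int_closed)
  moreover have "(1 / norm s) *\<^sub>R s \<in> sphere 0 1 \<inter> S"
    using s S by (simp add: subspace_scale)
  moreover have "continuous_on (sphere 0 1 \<inter> S) f"
    unfolding f_def by (intro continuous_intros linear_continuous_on)
  ultimately obtain v where v: "v \<in> sphere 0 1 \<inter> S" "\<And>y. y \<in> sphere 0 1 \<inter> S \<Longrightarrow> f y \<le> f v"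
    using continuous_attains_sup[of "sphere 0 1 \<inter> S" f] by blast
  have nv: "norm v = 1" and vS: "v \<in> S" using v(1) by auto
  have le: "f y \<le> f v * (y \<bullet> y)" if y: "y \<in> S" for y
  proof (cases "y = 0")
    case False
    have "f ((1 / norm y) *\<^sub>R y) \<le> f v"
      by (rule v(2)) (use y False S in \<open>simp add: subspace_scale\<close>)
    then have "f y / (norm y)\<^sup>2 \<le> f v"
      by (simp add: f_def matrix_vector_mult_scaleR power2_eq_square)
    then show ?thesis using False by (simp add: divide_le_eq power2_norm_eq_inner)
  qed (simp add: f_def)
  define w where "w = A *v v - f v *\<^sub>R v"
  have wS: "w \<in> S" unfolding w_def by (intro subspace_diff subspace_scale S vS inv)
  have "w \<bullet> w = 0"
  proof (rule ccontr)
    assume "w \<bullet> w \<noteq> 0"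
    then have wp: "w \<bullet> w > 0" by simp
    \<comment> \<open>The form \<open>f v * (y \<bullet> y) - f y\<close> is nonnegative on \<open>S\<close> and vanishes at \<open>v\<close>; along \<open>v + t w\<close>
      its linear term in \<open>t\<close> is a negative multiple of \<open>w \<bullet> w\<close>.\<close>
    have "2 * t * (w \<bullet> w) \<le> t\<^sup>2 * (f v * (w \<bullet> w) - f w)" for t
    proof -
      have Av: "A *v v = w + f v *\<^sub>R v" by (simp add: w_def)
      have "f (v + t *\<^sub>R w) = f v + 2 * t * (w \<bullet> (A *v v)) + t\<^sup>2 * f w"
        using inner_matrix_vector_symmetric[OF sym, of v w]
        by (simp add: f_def matrix_vector_mult_scaleR matrix_vector_right_distrib inner_add_left
            inner_add_right power2_eq_square algebra_simps inner_commute)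
      also have "w \<bullet> (A *v v) = w \<bullet> w + f v * (w \<bullet> v)"
        unfolding Av by (simp add: inner_add_right)
      finally have "f (v + t *\<^sub>R w) = f v + 2 * t * (w \<bullet> w + f v * (w \<bullet> v)) + t\<^sup>2 * f w" .
      moreover have "(v + t *\<^sub>R w) \<bullet> (v + t *\<^sub>R w) = v \<bullet> v + 2 * t * (w \<bullet> v) + t\<^sup>2 * (w \<bullet> w)"
        by (simp add: inner_add_left inner_add_right power2_eq_square inner_commute)
      moreover have "v \<bullet> v = 1" using nv by (simp add: norm_eq_1)
      moreover have "f (v + t *\<^sub>R w) \<le> f v * ((v + t *\<^sub>R w) \<bullet> (v + t *\<^sub>R w))"
        by (intro le subspace_add subspace_scale S vS wS)
      ultimately show ?thesis by (simp add: algebra_simps)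
    qed
    note * = this
    define K where "K = f v * (w \<bullet> w) - f w"
    define t where "t = (w \<bullet> w) / (\<bar>K\<bar> + 1)"
    have tp: "t > 0" using wp by (simp add: t_def)
    have "2 * t * (w \<bullet> w) \<le> t\<^sup>2 * K" using * K_def by simp
    then have "2 * (w \<bullet> w) \<le> t * K" using tp by (simp add: power2_eq_square)
    also have "t * K \<le> t * (\<bar>K\<bar> + 1)" using tp by (intro mult_left_mono) auto
    also have "\<dots> = w \<bullet> w" by (simp add: t_def)
    finally show False using wp by simp
  qed
  then have "A *v v = f v *\<^sub>R v" by (simp add: w_def)
  with that vS nv show thesis by blast
qed

text \<open>The orthogonal complement of an eigenvector inside \<open>S\<close> is again invariant and has smaller
  dimension.\<close>

lemma orthonormal_eigenbasis_of_invariant_subspace: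
  fixes A :: "real^'n^'n"
  assumes sym: "transpose A = A" and "subspace S" and "\<And>x. x \<in> S \<Longrightarrow> A *v x \<in> S"
  shows "\<exists>B l. finite B \<and> B \<subseteq> S \<and> pairwise orthogonal B \<and> (\<forall>b\<in>B. norm b = 1 \<and> A *v b = l b *\<^sub>R b)
    \<and> span B = S"
  using assms(2,3)
proof (induction "dim S" arbitrary: S rule: less_induct)
  case less
  show ?case
  proof (cases "S = {0}")
    case True
    then show ?thesis by (intro exI[of _ "{}"]) auto
  next
    case False
    obtain v l where v: "v \<in> S" "norm v = 1" "A *v v = l *\<^sub>R v"
      using invariant_subspace_has_eigenvector[OF sym less.prems False] by blast
    define T where "T = S \<inter> {x. v \<bullet> x = 0}"
    have T: "subspace T" unfolding T_def
      by (intro subspace_inter less.prems subspace_hyperplane)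
    have TS: "T \<subseteq> S" by (auto simp: T_def)
    have "v \<notin> T" using v by (auto simp: T_def norm_eq_1)
    then have "dim T < dim S"
      using TS T less.prems(1) v(1) by (metis dim_psubset psubsetI span_eq_iff)
    moreover have "A *v x \<in> T" if "x \<in> T" for x
      using that less.prems(2) v(3) inner_matrix_vector_symmetric[OF sym, of v x]
      by (auto simp: T_def)
    ultimately obtain B m where B: "finite B" "B \<subseteq> T" "pairwise orthogonal B"
      "\<And>b. b \<in> B \<Longrightarrow> norm b = 1 \<and> A *v b = m b *\<^sub>R b" "span B = T"
      using less.hyps[of T] T by blast
    have vB: "v \<notin> B" using \<open>v \<notin> T\<close> B(2) by auto
    have "span (insert v B) = S"
    proof
      show "span (insert v B) \<subseteq> S"
        using v(1) B(2) TS less.prems(1) by (intro span_minimal) auto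
      show "S \<subseteq> span (insert v B)"
      proof
        fix x assume x: "x \<in> S"
        have "x - (v \<bullet> x) *\<^sub>R v \<in> T"
          using x v less.prems(1)
          by (auto simp: T_def subspace_diff subspace_scale inner_diff_right norm_eq_1)
        then show "x \<in> span (insert v B)"
          using B(5) by (auto simp: span_insert)
      qed
    qed
    moreover have "pairwise orthogonal (insert v B)"
      using B(2,3) by (auto simp: pairwise_insert T_def orthogonal_def inner_commute)
    ultimately show ?thesis
      using B v vB TS
      by (intro exI[of _ "insert v B"] exI[of _ "m(v := l)"]) auto
  qed
qed

text \<open>The basis is a set of vectors, not an indexed family, so that no bijection with the index type of
  the matrix has to be chosen.\<close>

theorem symmetric_orthonormal_eigenbasis:
  fixes A :: "real^'n^'n"
  assumes "transpose A = A"
  obtains B l where "finite B" "pairwise orthogonal B" "\<And>b. b \<in> B \<Longrightarrow> norm b = 1"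
    "\<And>b. b \<in> B \<Longrightarrow> A *v b = l b *\<^sub>R b" "\<And>x. x = (\<Sum>b\<in>B. (x \<bullet> b) *\<^sub>R b)"
proof -
  obtain B l where B: "finite B" "pairwise orthogonal B"
    "\<And>b. b \<in> B \<Longrightarrow> norm b = 1 \<and> A *v b = l b *\<^sub>R b" "span B = UNIV"
    using orthonormal_eigenbasis_of_invariant_subspace[OF assms subspace_UNIV] by blast
  have "x = (\<Sum>b\<in>B. (x \<bullet> b) *\<^sub>R b)" for x
    using orthonormal_basis_expand[OF B(2) _ _ B(1), of x] B(3,4) by auto
  with B that show thesis by blast
qed

section \<open>The positive semidefinite square root\<close>

lemma symmetric_matrixI:
  fixes B :: "real^'n^'n"
  assumes "\<And>x y. x \<bullet> (B *v y) = (B *v x) \<bullet> y"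
  shows "transpose B = B"
proof -
  have "B $ j $ i = B $ i $ j" for i j
    using assms[of "axis j 1" "axis i 1"]
    by (simp add: inner_axis inner_axis' matrix_vector_mul_component inner_commute)
  then show ?thesis by (simp add: transpose_def vec_eq_iff)
qed

lemma psd_sqrt_exists:
  fixes A :: "real^'n^'n"
  assumes "psd A"
  shows "\<exists>B. psd B \<and> B ** B = A"
proof -
  obtain E l where E: "finite E" "pairwise orthogonal E" "\<And>b. b \<in> E \<Longrightarrow> norm b = 1"
    "\<And>b. b \<in> E \<Longrightarrow> A *v b = l b *\<^sub>R b" "\<And>x. x = (\<Sum>b\<in>E. (x \<bullet> b) *\<^sub>R b)"
    using symmetric_orthonormal_eigenbasis[of A] assms unfolding psd_def by blast
  have l: "l b \<ge> 0" if "b \<in> E" for b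
  proof -
    have "0 \<le> b \<bullet> (A *v b)" using assms by (simp add: psd_def)
    then show ?thesis using E(3,4)[OF that] by (simp add: norm_eq_1)
  qed
  define f where "f x = (\<Sum>b\<in>E. (sqrt (l b) * (x \<bullet> b)) *\<^sub>R b)" for x
  have "linear f"
    by (rule linearI) (simp_all add: f_def inner_add_left algebra_simps sum.distrib scaleR_sum_right)
  define B where "B = matrix f"
  have Bf: "B *v x = f x" for x
    using \<open>linear f\<close> by (simp add: B_def matrix_works)
  have "x \<bullet> f y = f x \<bullet> y" for x y
    by (simp add: f_def inner_sum_left inner_sum_right ac_simps inner_commute)
  then have "transpose B = B" by (intro symmetric_matrixI) (simp add: Bf)
  moreover have "0 \<le> x \<bullet> (B *v x)" for x
    unfolding Bf f_def using l by (auto simp: inner_sum_right mult.assoc intro!: sum_nonneg)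
  ultimately have "psd B" by (simp add: psd_def)
  moreover have "(B ** B) *v x = A *v x" for x
  proof -
    have fb: "f b = sqrt (l b) *\<^sub>R b" if b: "b \<in> E" for b
    proof -
      have "f b = (\<Sum>c\<in>E. if c = b then sqrt (l b) *\<^sub>R b else 0)"
        unfolding f_def using E(2,3) b
        by (intro sum.cong) (auto simp: pairwise_def orthogonal_def norm_eq_1)
      then show ?thesis using b E(1) by simp
    qed
    have "f (f x) = (\<Sum>b\<in>E. (sqrt (l b) * (x \<bullet> b)) *\<^sub>R f b)"
      by (subst (2) f_def) (simp add: linear_sum[OF \<open>linear f\<close>] linear_cmul[OF \<open>linear f\<close>])
    also have "\<dots> = (\<Sum>b\<in>E. (x \<bullet> b) *\<^sub>R (A *v b))"
      by (intro sum.cong refl) (use l in \<open>simp add: fb E(4) mult.commute\<close>)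
    also have "\<dots> = A *v (\<Sum>b\<in>E. (x \<bullet> b) *\<^sub>R b)"
      by (simp add: linear_sum[OF matrix_vector_mul_linear] matrix_vector_mult_scaleR)
    also have "\<dots> = A *v x" by (rule arg_cong[where f = "(*v) A", OF E(5)[symmetric]])
    finally show ?thesis by (simp add: Bf flip: matrix_vector_mul_assoc)
  qed
  ultimately show ?thesis using matrix_eq by blast
qed

text \<open>This bound yields both uniqueness and continuity of the square root. Let \<open>b\<close> be a unit
  eigenvector of \<open>B - C\<close> with eigenvalue \<open>l\<close>, and write \<open>p\<close> and \<open>q\<close> for the values of the forms of \<open>B\<close>
  and \<open>C\<close> at \<open>b\<close>. Then \<open>l = p - q\<close>, while the form of \<open>B ** B - C ** C\<close> takes the value \<open>l * (p + q)\<close>,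
  whose absolute value is at least \<open>l\<^sup>2\<close> because \<open>p\<close> and \<open>q\<close> are nonnegative.\<close>

lemma square_root_difference_bound:
  fixes B C :: "real^'n^'n"
  assumes "psd B" "psd C" and e: "\<And>x. \<bar>x \<bullet> ((B ** B - C ** C) *v x)\<bar> \<le> e * (norm x)\<^sup>2"
  shows "(norm ((B - C) *v x))\<^sup>2 \<le> e * (norm x)\<^sup>2"
proof -
  let ?D = "B - C"
  have sB: "transpose B = B" and sC: "transpose C = C" using assms by (auto simp: psd_def)
  then have sym: "transpose ?D = ?D" by (simp add: transpose_def vec_eq_iff)
  obtain E l where E: "finite E" "pairwise orthogonal E" "\<And>b. b \<in> E \<Longrightarrow> norm b = 1"
    "\<And>b. b \<in> E \<Longrightarrow> ?D *v b = l b *\<^sub>R b" "\<And>x. x = (\<Sum>b\<in>E. (x \<bullet> b) *\<^sub>R b)"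
    using symmetric_orthonormal_eigenbasis[OF sym] by blast
  have parseval: "(norm y)\<^sup>2 = (\<Sum>b\<in>E. (y \<bullet> b)\<^sup>2)" for y
  proof -
    have "y \<bullet> y = (\<Sum>b\<in>E. (y \<bullet> b) *\<^sub>R b) \<bullet> y"
      by (rule arg_cong[where f = "\<lambda>z. z \<bullet> y", OF E(5)])
    also have "\<dots> = (\<Sum>b\<in>E. (y \<bullet> b) * (b \<bullet> y))" by (simp only: inner_sum_left inner_scaleR_left)
    also have "\<dots> = (\<Sum>b\<in>E. (y \<bullet> b)\<^sup>2)"
      by (intro sum.cong refl) (simp add: power2_eq_square inner_commute)
    finally show ?thesis by (simp only: power2_norm_eq_inner)
  qed
  have l: "(l b)\<^sup>2 \<le> e" if b: "b \<in> E" for b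
  proof -
    define p where "p = b \<bullet> (B *v b)"
    define q where "q = b \<bullet> (C *v b)"
    have pq: "p \<ge> 0" "q \<ge> 0" using assms by (auto simp: psd_def p_def q_def)
    have D: "B *v b - C *v b = l b *\<^sub>R b"
      using E(4)[OF b] by (simp add: matrix_vector_mult_diff_rdistrib)
    have lpq: "l b = p - q"
      using E(3)[OF b] D by (simp add: p_def q_def norm_eq_1 flip: inner_diff_right)
    have "b \<bullet> ((B ** B - C ** C) *v b) = (B *v b) \<bullet> (B *v b) - (C *v b) \<bullet> (C *v b)"
      by (simp add: matrix_vector_mult_diff_rdistrib inner_diff_right
          inner_matrix_vector_symmetric[OF sB] inner_matrix_vector_symmetric[OF sC]
          flip: matrix_vector_mul_assoc)
    also have "\<dots> = (B *v b - C *v b) \<bullet> (B *v b + C *v b)"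
      by (simp add: inner_diff_left inner_diff_right inner_add_right inner_commute)
    also have "\<dots> = l b * (p + q)" unfolding D by (simp add: p_def q_def inner_add_right distrib_left)
    finally have "\<bar>l b * (p + q)\<bar> \<le> e" using e[of b] E(3)[OF b] by simp
    moreover have "\<bar>l b * (p + q)\<bar> = \<bar>p - q\<bar> * (p + q)" using pq lpq by (simp add: abs_mult)
    moreover have "\<bar>p - q\<bar> * \<bar>p - q\<bar> \<le> \<bar>p - q\<bar> * (p + q)"
      using pq by (intro mult_left_mono) auto
    ultimately show ?thesis by (simp add: lpq power2_eq_square flip: abs_mult)
  qed
  have "(norm (?D *v x))\<^sup>2 = (\<Sum>b\<in>E. (l b)\<^sup>2 * (x \<bullet> b)\<^sup>2)"
    unfolding parseval
    by (intro sum.cong refl)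
      (simp add: E(4) power_mult_distrib flip: inner_matrix_vector_symmetric[OF sym])
  also have "\<dots> \<le> (\<Sum>b\<in>E. e * (x \<bullet> b)\<^sup>2)"
    by (intro sum_mono mult_right_mono l) auto
  also have "\<dots> = e * (norm x)\<^sup>2" by (simp add: parseval sum_distrib_left)
  finally show ?thesis .
qed

lemma psd_square_root_unique:
  fixes B C :: "real^'n^'n"
  assumes "psd B" "psd C" "B ** B = C ** C"
  shows "B = C"
proof -
  have "(norm ((B - C) *v x))\<^sup>2 \<le> 0 * (norm x)\<^sup>2" for x
    by (rule square_root_difference_bound[OF assms(1,2)]) (simp add: assms(3))
  then show ?thesis by (simp add: matrix_eq matrix_vector_mult_diff_rdistrib)
qed

lemma psd_sqrt:
  fixes A :: "real^'n^'n"
  assumes "psd A"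
  shows psd_psd_sqrt: "psd (psd_sqrt A)" and psd_sqrt_square: "psd_sqrt A ** psd_sqrt A = A"
proof -
  obtain B where B: "psd B \<and> B ** B = A" using psd_sqrt_exists[OF assms] by blast
  have "psd (psd_sqrt A) \<and> psd_sqrt A ** psd_sqrt A = A"
    unfolding psd_sqrt_def using B
    by (rule theI) (use B psd_square_root_unique in metis)
  then show "psd (psd_sqrt A)" "psd_sqrt A ** psd_sqrt A = A" by auto
qed

lemma norm_matrix_power2:
  fixes A :: "real^'n^'m"
  shows "(norm A)\<^sup>2 = (\<Sum>i\<in>UNIV. (norm (A $ i))\<^sup>2)"
  by (simp add: power2_norm_eq_inner inner_vec_def)

lemma norm_matrix_vector_mult_le:
  fixes A :: "real^'n^'m"
  shows "norm (A *v x) \<le> norm A * norm x"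
proof -
  have "(norm (A *v x))\<^sup>2 = (\<Sum>i\<in>UNIV. (A $ i \<bullet> x)\<^sup>2)"
    unfolding power2_norm_eq_inner inner_vec_def[of "A *v x" "A *v x"]
    by (intro sum.cong refl) (simp add: matrix_vector_mul_component power2_eq_square)
  also have "\<dots> \<le> (\<Sum>i\<in>UNIV. (norm (A $ i))\<^sup>2 * (norm x)\<^sup>2)"
  proof (rule sum_mono)
    fix i
    have "\<bar>A $ i \<bullet> x\<bar>\<^sup>2 \<le> (norm (A $ i) * norm x)\<^sup>2"
      by (intro power_mono Cauchy_Schwarz_ineq2) auto
    then show "(A $ i \<bullet> x)\<^sup>2 \<le> (norm (A $ i))\<^sup>2 * (norm x)\<^sup>2"
      by (simp add: power_mult_distrib)
  qed
  also have "\<dots> = (norm A * norm x)\<^sup>2"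
    by (simp add: norm_matrix_power2 power_mult_distrib sum_distrib_right)
  finally show ?thesis by (rule power2_le_imp_le) simp
qed

text \<open>Applied to the coordinate vectors, the previous bound makes the square root Hoelder continuous
  with exponent one half in the Frobenius norm.\<close>

lemma continuous_on_psd_sqrt: "continuous_on {A :: real^'n^'n. psd A} psd_sqrt"
proof -
  have bound: "(norm (psd_sqrt A - psd_sqrt B))\<^sup>2 \<le> real CARD('n) * norm (A - B)"
    if "psd A" "psd B" for A B :: "real^'n^'n"
  proof -
    let ?D = "psd_sqrt A - psd_sqrt B"
    have e: "\<bar>x \<bullet> ((psd_sqrt A ** psd_sqrt A - psd_sqrt B ** psd_sqrt B) *v x)\<bar>
        \<le> norm (A - B) * (norm x)\<^sup>2" for x
    proof -
      have "\<bar>x \<bullet> ((A - B) *v x)\<bar> \<le> norm x * norm ((A - B) *v x)"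
        by (rule Cauchy_Schwarz_ineq2)
      also have "\<dots> \<le> norm x * (norm (A - B) * norm x)"
        by (intro mult_left_mono norm_matrix_vector_mult_le) auto
      finally show ?thesis by (simp add: psd_sqrt_square that power2_eq_square ac_simps)
    qed
    have sym: "transpose ?D = ?D"
      using psd_psd_sqrt[OF that(1)] psd_psd_sqrt[OF that(2)]
      by (simp add: psd_def transpose_def vec_eq_iff)
    have row: "?D $ i = ?D *v axis i 1" for i
      using arg_cong[OF sym, of "\<lambda>M. M $ i"]
      by (simp add: matrix_vector_mult_basis column_def transpose_def)
    have "(norm ?D)\<^sup>2 \<le> (\<Sum>i\<in>(UNIV::'n set). norm (A - B))"
      unfolding norm_matrix_power2
    proof (rule sum_mono)
      fix i :: 'n
      have "(norm (?D *v axis i 1))\<^sup>2 \<le> norm (A - B) * (norm (axis i 1 :: real^'n))\<^sup>2"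
        by (rule square_root_difference_bound) (use that psd_psd_sqrt e in auto)
      then show "(norm (?D $ i))\<^sup>2 \<le> norm (A - B)" by (simp only: row norm_axis_1 power_one mult_1_right)
    qed
    then show ?thesis by simp
  qed
  show ?thesis
    unfolding continuous_on_def
  proof safe
    fix A :: "real^'n^'n" assume A: "psd A"
    have "((\<lambda>B. sqrt (real CARD('n) * norm (B - A))) \<longlongrightarrow> sqrt (real CARD('n) * norm (A - A)))
      (at A within {A. psd A})"
      by (intro tendsto_intros)
    then have "((\<lambda>B. sqrt (real CARD('n) * norm (B - A))) \<longlongrightarrow> 0) (at A within {A. psd A})" by simp
    then have "((\<lambda>B. psd_sqrt B - psd_sqrt A) \<longlongrightarrow> 0) (at A within {A. psd A})"
    proof (rule Lim_null_comparison[rotated])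
      show "\<forall>\<^sub>F B in at A within {A. psd A}. norm (psd_sqrt B - psd_sqrt A)
          \<le> sqrt (real CARD('n) * norm (B - A))"
        using bound[OF _ A] by (auto simp: eventually_at_filter real_le_rsqrt)
    qed
    then show "(psd_sqrt \<longlongrightarrow> psd_sqrt A) (at A within {A. psd A})"
      by (subst Lim_null)
  qed
qed

section \<open>Positive definite matrices and quadratic forms\<close>

lemma pos_def_imp_psd: "pos_def A \<Longrightarrow> psd A"
  unfolding pos_def_def psd_def by (metis inner_zero_left less_eq_real_def order_refl)

lemma inner_matrix_trace:
  fixes A B :: "real^'n^'m"
  shows "A \<bullet> B = trace (transpose A ** B)"
proof -
  have "A \<bullet> B = (\<Sum>i\<in>UNIV. \<Sum>j\<in>UNIV. A $ i $ j * B $ i $ j)" by (simp add: inner_vec_def)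
  also have "\<dots> = (\<Sum>j\<in>UNIV. \<Sum>i\<in>UNIV. A $ i $ j * B $ i $ j)" by (rule sum.swap)
  finally show ?thesis by (simp add: trace_def matrix_matrix_mult_def transpose_def)
qed

lemma inner_matrix_columns:
  fixes A B :: "real^'n^'m"
  shows "A \<bullet> B = (\<Sum>j\<in>UNIV. column j A \<bullet> column j B)"
proof -
  have "A \<bullet> B = (\<Sum>i\<in>UNIV. \<Sum>j\<in>UNIV. A $ i $ j * B $ i $ j)" by (simp add: inner_vec_def)
  also have "\<dots> = (\<Sum>j\<in>UNIV. \<Sum>i\<in>UNIV. A $ i $ j * B $ i $ j)" by (rule sum.swap)
  finally show ?thesis by (simp add: column_def inner_vec_def)
qed

lemma column_matrix_mult:
  fixes A :: "real^'n^'m" and B :: "real^'k^'n"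
  shows "column j (A ** B) = A *v column j B"
  by (simp add: vec_eq_iff column_def matrix_matrix_mult_def matrix_vector_mult_def)

lemma linear_matrix_mult_left: "linear (\<lambda>B::real^'k^'n. (A::real^'n^'m) ** B)"
  by (rule linearI)
    (simp_all add: vec_eq_iff matrix_matrix_mult_def distrib_left sum.distrib sum_distrib_left mult_ac)

lemma inner_matrix_mult_symmetric:
  fixes X A B :: "real^'n^'n"
  assumes "transpose X = X"
  shows "A \<bullet> (X ** B) = (X ** A) \<bullet> B"
  unfolding inner_matrix_columns column_matrix_mult
  by (simp only: inner_matrix_vector_symmetric[OF assms])

lemma inner_matrix_mult_nonneg:
  fixes X B :: "real^'n^'n"
  assumes "psd X"
  shows "0 \<le> B \<bullet> (X ** B)"
  unfolding inner_matrix_columns column_matrix_mult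
  by (intro sum_nonneg) (use assms in \<open>simp add: psd_def\<close>)

lemma inner_matrix_mult_pos:
  fixes X B :: "real^'n^'n"
  assumes X: "pos_def X" and "B \<noteq> 0"
  shows "0 < B \<bullet> (X ** B)"
proof -
  obtain i j where "B $ i $ j \<noteq> 0" using \<open>B \<noteq> 0\<close> by (auto simp: vec_eq_iff)
  then have "column j B \<noteq> 0" by (auto simp: column_def vec_eq_iff)
  then have "0 < column j B \<bullet> (X *v column j B)" using X by (simp add: pos_def_def)
  then show ?thesis
    unfolding inner_matrix_columns column_matrix_mult
    using pos_def_imp_psd[OF X] by (intro sum_pos2[of _ j]) (auto simp: psd_def)
qed

lemma matrix_inv_inverse:
  fixes A :: "real^'n^'n"
  assumes "invertible A"
  shows "A ** matrix_inv A = mat 1" and "matrix_inv A ** A = mat 1"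
  using someI_ex[OF assms[unfolded invertible_def]] by (auto simp: matrix_inv_def)

lemma invertible_pos_def:
  fixes K :: "real^'n^'n"
  assumes "pos_def K"
  shows "invertible K"
proof -
  have "x = 0" if "K *v x = 0" for x
    using assms that unfolding pos_def_def by (metis inner_zero_right less_irrefl)
  then show ?thesis
    by (metis invertible_left_inverse matrix_left_invertible_ker)
qed

lemma transpose_matrix_inv_pos_def:
  fixes K :: "real^'n^'n"
  assumes "pos_def K"
  shows "transpose (matrix_inv K) = matrix_inv K"
proof -
  note V = matrix_inv_inverse[OF invertible_pos_def[OF assms]]
  have "transpose (matrix_inv K) ** K = mat 1"
    using arg_cong[OF V(1), of transpose] assms by (simp add: matrix_transpose_mul pos_def_def)
  then show ?thesis by (metis V(1) matrix_mul_assoc matrix_mul_lid matrix_mul_rid)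
qed

lemma mat_vector_mult: "mat c *v x = c *\<^sub>R (x :: real^'n)"
  by (simp add: vec_eq_iff matrix_vector_mult_def mat_def if_distrib if_distribR cong: if_cong)

lemma pos_def_mat_diff_imp_pos:
  fixes X :: "real^'n^'n"
  assumes "pos_def X" "pos_def (mat \<gamma> - X)"
  shows "\<gamma> > 0"
proof -
  obtain u :: "real^'n" where u: "norm u = 1" using vector_choose_size[of 1] by auto
  then have "u \<noteq> 0" by auto
  then have "0 < u \<bullet> (X *v u)" "0 < u \<bullet> ((mat \<gamma> - X) *v u)" using assms by (auto simp: pos_def_def)
  moreover have "u \<bullet> ((mat \<gamma> - X) *v u) = \<gamma> - u \<bullet> (X *v u)"
    using u by (simp add: matrix_vector_mult_diff_rdistrib mat_vector_mult inner_diff_right norm_eq_1)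
  ultimately show ?thesis by linarith
qed

text \<open>The identity behind both weak duality and the Schur complement: for fixed \<open>z\<close>, the left-hand side
  is minimized over \<open>w\<close>, with value 0, at \<open>matrix_inv K *v z\<close>.\<close>

lemma complete_square:
  fixes K :: "real^'n^'n"
  assumes K: "pos_def K"
  shows "w \<bullet> (K *v w) - 2 * (z \<bullet> w) + z \<bullet> (matrix_inv K *v z)
    = (w - matrix_inv K *v z) \<bullet> (K *v (w - matrix_inv K *v z))"
proof -
  define v where "v = matrix_inv K *v z"
  have Kv: "K *v v = z"
    using matrix_inv_inverse(1)[OF invertible_pos_def[OF K]]
    by (simp add: v_def matrix_vector_mul_assoc)
  have "v \<bullet> (K *v w) = z \<bullet> w"
    using inner_matrix_vector_symmetric[of K v w] K by (simp add: Kv pos_def_def)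
  then show ?thesis
    unfolding v_def[symmetric] matrix_vector_mult_diff_distrib inner_diff_left inner_diff_right Kv
    by (simp add: inner_commute)
qed

lemma psd_matrix_inv:
  fixes K :: "real^'n^'n"
  assumes "pos_def K"
  shows "psd (matrix_inv K)"
proof -
  have "0 \<le> z \<bullet> (matrix_inv K *v z)" for z
  proof -
    have "0 \<le> (0 - matrix_inv K *v z) \<bullet> (K *v (0 - matrix_inv K *v z))"
      using pos_def_imp_psd[OF assms] unfolding psd_def by blast
    then show ?thesis unfolding complete_square[OF assms, symmetric] by simp
  qed
  then show ?thesis using transpose_matrix_inv_pos_def[OF assms] by (simp add: psd_def)
qed

text \<open>For fixed \<open>z\<close>, the penalized loss \<open>w \<bullet> (X *v w) - \<gamma> * (norm (w - z))\<^sup>2\<close> has the maximum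
  \<open>\<gamma>\<^sup>2 * (z \<bullet> (V *v z)) - \<gamma> * (norm z)\<^sup>2\<close>, attained at \<open>w = \<gamma> *\<^sub>R (V *v z)\<close>.\<close>

lemma penalized_quadratic_gap:
  fixes X :: "real^'n^'n"
  assumes K: "pos_def (mat \<gamma> - X)"
  defines "V \<equiv> matrix_inv (mat \<gamma> - X)"
  shows "\<gamma> * (norm (w - z))\<^sup>2 + (\<gamma>\<^sup>2 * (z \<bullet> (V *v z)) - \<gamma> * (norm z)\<^sup>2) - w \<bullet> (X *v w)
    = (w - \<gamma> *\<^sub>R (V *v z)) \<bullet> ((mat \<gamma> - X) *v (w - \<gamma> *\<^sub>R (V *v z)))"
proof -
  have "w \<bullet> ((mat \<gamma> - X) *v w) = \<gamma> * (w \<bullet> w) - w \<bullet> (X *v w)"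
    by (simp add: matrix_vector_mult_diff_rdistrib mat_vector_mult inner_diff_right)
  moreover have "(norm (w - z))\<^sup>2 = w \<bullet> w - 2 * (z \<bullet> w) + z \<bullet> z"
    unfolding power2_norm_eq_inner by (simp add: inner_diff_left inner_diff_right inner_commute)
  moreover have "(w - \<gamma> *\<^sub>R (V *v z)) \<bullet> ((mat \<gamma> - X) *v (w - \<gamma> *\<^sub>R (V *v z)))
      = w \<bullet> ((mat \<gamma> - X) *v w) - 2 * (\<gamma> * (z \<bullet> w)) + \<gamma>\<^sup>2 * (z \<bullet> (V *v z))"
    using complete_square[OF K, of w "\<gamma> *\<^sub>R z"]
    unfolding V_def[symmetric] matrix_vector_mult_scaleR inner_scaleR_left inner_scaleR_right
    by (simp only: power2_eq_square mult.assoc)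
  ultimately show ?thesis
    by (simp only: power2_norm_eq_inner) (simp only: algebra_simps)
qed

text \<open>The same maximum with a matrix in place of \<open>w\<close>, obtained by summing over the columns.\<close>

lemma penalized_matrix_quadratic:
  fixes X A :: "real^'n^'n"
  assumes K: "pos_def (mat \<gamma> - X)"
  defines "V \<equiv> matrix_inv (mat \<gamma> - X)"
  shows "B \<bullet> (X ** B) \<le> \<gamma> * (norm (B - A))\<^sup>2 + (\<gamma>\<^sup>2 * (A \<bullet> (V ** A)) - \<gamma> * (norm A)\<^sup>2)" (is ?le)
    and "\<exists>B. B \<bullet> (X ** B) = \<gamma> * (norm (B - A))\<^sup>2 + (\<gamma>\<^sup>2 * (A \<bullet> (V ** A)) - \<gamma> * (norm A)\<^sup>2)" (is ?eq)
proof -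
  have gap: "\<gamma> * (norm (B - A))\<^sup>2 + (\<gamma>\<^sup>2 * (A \<bullet> (V ** A)) - \<gamma> * (norm A)\<^sup>2) - B \<bullet> (X ** B)
    = (B - \<gamma> *\<^sub>R (V ** A)) \<bullet> ((mat \<gamma> - X) ** (B - \<gamma> *\<^sub>R (V ** A)))" for B
  proof -
    have col: "column j (B - \<gamma> *\<^sub>R (V ** A)) = column j B - \<gamma> *\<^sub>R (V *v column j A)"
      "column j (B - A) = column j B - column j A" for j
      by (simp_all add: column_matrix_mult[symmetric]) (simp_all add: column_def vec_eq_iff)
    show ?thesis
      unfolding power2_norm_eq_inner inner_matrix_columns column_matrix_mult col
        penalized_quadratic_gap[OF K, folded V_def, symmetric]
      by (simp add: sum_subtractf sum.distrib sum_distrib_left power2_norm_eq_inner)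
  qed
  show ?le
    using gap[of B] inner_matrix_mult_nonneg[OF pos_def_imp_psd[OF K]] by (metis diff_ge_0_iff_ge)
  show ?eq
    using gap[of "\<gamma> *\<^sub>R (V ** A)"] linear_0[OF linear_matrix_mult_left]
    by (intro exI[of _ "\<gamma> *\<^sub>R (V ** A)"]) simp
qed

text \<open>The determinant of \<open>B + mat x\<close> is a polynomial in \<open>x\<close>. It is not the zero polynomial, since
  \<open>B + mat x\<close> is injective for \<open>x > norm B\<close>; so it has finitely many roots.\<close>

lemma closure_invertible_matrices: "closure {B :: real^'n^'n. invertible B} = UNIV"
proof -
  have "B \<in> closure {B. invertible B}" for B :: "real^'n^'n"
    unfolding closure_approachable
  proof safe
    fix e :: real assume e: "e > 0"
    define p where "p = det (\<chi> i j. [:B $ i $ j, if i = j then 1 else 0:])"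
    have p: "poly p x = det (B + mat x)" for x
      by (auto simp: p_def det_def poly_sum poly_prod mat_def intro!: sum.cong prod.cong)
    have "invertible (B + mat (norm B + 1))"
    proof -
      have "x = 0" if "(B + mat (norm B + 1)) *v x = 0" for x
      proof -
        have "B *v x = - ((norm B + 1) *\<^sub>R x)"
          using that by (simp add: matrix_vector_mult_add_rdistrib mat_vector_mult eq_neg_iff_add_eq_0)
        then have "(norm B + 1) * norm x \<le> norm B * norm x"
          using norm_matrix_vector_mult_le[of B x] by simp
        then show ?thesis by (simp add: distrib_right)
      qed
      then show ?thesis
        by (metis invertible_left_inverse matrix_left_invertible_ker)
    qed
    then have "p \<noteq> 0" using p[of "norm B + 1"] by (auto simp: invertible_det_nz)
    then have fin: "finite {x. poly p x = 0}" by (rule poly_roots_finite)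
    define M where "M = norm (mat 1 :: real^'n^'n) + 1"
    have M: "M > 0" by (simp add: M_def add_nonneg_pos)
    have "infinite {0<..<e / M}" using e M by simp
    then obtain x where x: "x \<in> {0<..<e / M}" "poly p x \<noteq> 0"
      using fin by (metis (mono_tags, lifting) finite_subset mem_Collect_eq subsetI)
    have "mat x = x *\<^sub>R (mat 1 :: real^'n^'n)" by (simp add: mat_def vec_eq_iff)
    then have "dist (B + mat x) B = x * norm (mat 1 :: real^'n^'n)"
      using x by (simp add: dist_norm)
    also have "\<dots> \<le> x * M" using x by (intro mult_left_mono) (auto simp: M_def)
    also have "\<dots> < e" using x M by (simp add: field_simps)
    finally show "\<exists>C\<in>{B. invertible B}. dist C B < e"
      using x(2) p by (intro bexI[of _ "B + mat x"]) (auto simp: invertible_det_nz)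
  qed
  then show ?thesis by auto
qed

section \<open>The standard normal distribution\<close>

lemma linear_borel_measurable:
  fixes f :: "'a::euclidean_space \<Rightarrow> 'b::real_normed_vector"
  shows "linear f \<Longrightarrow> f \<in> borel_measurable borel"
  by (intro borel_measurable_continuous_onI linear_continuous_on) (simp add: linear_linear)

lemma measurable_matrix_vector_mult [measurable]:
  fixes B :: "real^'n^'m"
  shows "(\<lambda>z. B *v z) \<in> borel_measurable borel"
  by (intro linear_borel_measurable matrix_vector_mul_linear)

text \<open>The image measure \<open>\<nu>\<close> of Lebesgue measure under a linear bijection is translation invariant, and
  two \<open>\<sigma>\<close>-finite translation-invariant measures \<open>\<lambda>\<close> and \<open>\<nu>\<close> are proportional: shifting the variables in the
  product integral of \<open>indicator A x * indicator B y\<close> one at a time gives \<open>\<lambda> A * \<nu> B = \<nu> A * \<lambda> B\<close>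
  when \<open>B\<close> is symmetric about the origin. For the unit ball \<open>B\<close> the two measures agree.\<close>

lemma distr_lborel_orthogonal_transformation:
  fixes f :: "'a::euclidean_space \<Rightarrow> 'a"
  assumes f: "orthogonal_transformation f"
  shows "distr lborel borel f = lborel"
proof (rule measure_eqI)
  let ?\<nu> = "distr lborel borel f"
  let ?B = "ball 0 1 :: 'a set"
  have lin: "linear f" using f by (rule orthogonal_transformation_linear)
  have [measurable]: "f \<in> borel_measurable borel"
    using lin by (rule linear_borel_measurable)
  have ball: "f -` ball 0 r = ball 0 r" for r
    using f by (auto simp: orthogonal_transformation)
  have ball_eq: "emeasure ?\<nu> (ball 0 r) = emeasure lborel (ball 0 r :: 'a set)" for r
    by (subst emeasure_distr) (auto simp: ball)
  show "sets ?\<nu> = sets lborel" by simp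
  have sf\<nu>: "sigma_finite_measure ?\<nu>"
  proof
    have "x \<in> \<Union> (range (\<lambda>n. ball 0 (real n)))" for x :: 'a
      using reals_Archimedean2[of "norm x"] by auto
    then have "\<Union> (range (\<lambda>n. ball 0 (real n))) = (UNIV :: 'a set)" by auto
    then show "\<exists>A. countable A \<and> A \<subseteq> sets ?\<nu> \<and> \<Union> A = space ?\<nu> \<and> (\<forall>a\<in>A. emeasure ?\<nu> a \<noteq> \<infinity>)"
      using emeasure_lborel_ball_finite[of "0::'a"]
      by (intro exI[of _ "range (\<lambda>n. ball 0 (real n))"]) (auto simp: ball_eq less_top)
  qed
  interpret pair_sigma_finite "lborel :: 'a measure" ?\<nu>
    by (intro pair_sigma_finite.intro sf\<nu> sigma_finite_lborel)
  have shift_lborel: "(\<integral>\<^sup>+x. g (c + x) \<partial>lborel) = (\<integral>\<^sup>+x. g x \<partial>lborel)"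
    if [measurable]: "g \<in> borel_measurable borel" for g :: "'a \<Rightarrow> ennreal" and c
    by (subst (2) lborel_distr_plus[symmetric, of c]) (simp add: nn_integral_distr)
  have shift_\<nu>: "(\<integral>\<^sup>+x. g (c + x) \<partial>?\<nu>) = (\<integral>\<^sup>+x. g x \<partial>?\<nu>)"
    if [measurable]: "g \<in> borel_measurable borel" for g :: "'a \<Rightarrow> ennreal" and c
  proof -
    obtain d where d: "c = f d" using orthogonal_transformation_surj[OF f] by (metis surjD)
    have "(\<integral>\<^sup>+x. g (c + x) \<partial>?\<nu>) = (\<integral>\<^sup>+x. g (f (d + x)) \<partial>lborel)"
      by (simp add: nn_integral_distr d linear_add[OF lin])
    also have "\<dots> = (\<integral>\<^sup>+x. g (f x) \<partial>lborel)"
      by (rule shift_lborel) measurable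
    finally show ?thesis by (simp add: nn_integral_distr)
  qed
  fix A assume "A \<in> sets ?\<nu>"
  then have A[measurable]: "A \<in> sets borel" by simp
  have B[measurable]: "?B \<in> sets borel" by simp
  have "emeasure lborel A * emeasure ?\<nu> ?B
      = (\<integral>\<^sup>+y. (\<integral>\<^sup>+x. indicator A x * indicator ?B y \<partial>lborel) \<partial>?\<nu>)"
    by (simp add: nn_integral_multc nn_integral_cmult)
  also have "\<dots> = (\<integral>\<^sup>+y. (\<integral>\<^sup>+x. indicator A (y + x) * indicator ?B y \<partial>lborel) \<partial>?\<nu>)"
    by (intro nn_integral_cong
        shift_lborel[of "\<lambda>x. indicator A x * indicator ?B y" y for y, symmetric]) measurable
  also have "\<dots> = (\<integral>\<^sup>+x. (\<integral>\<^sup>+y. indicator A (y + x) * indicator ?B y \<partial>?\<nu>) \<partial>lborel)"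
    by (rule Fubini') measurable
  also have "\<dots> = (\<integral>\<^sup>+x. (\<integral>\<^sup>+y. indicator A y * indicator ?B (y - x) \<partial>?\<nu>) \<partial>lborel)"
  proof (rule nn_integral_cong)
    fix x
    have "(\<integral>\<^sup>+y. indicator A (y + x) * indicator ?B y \<partial>?\<nu>)
        = (\<integral>\<^sup>+y. indicator A (x + y) * indicator ?B (x + y - x) \<partial>?\<nu>)"
      by (simp add: add.commute)
    also have "\<dots> = (\<integral>\<^sup>+y. indicator A y * indicator ?B (y - x) \<partial>?\<nu>)"
      by (rule shift_\<nu>) measurable
    finally show "(\<integral>\<^sup>+y. indicator A (y + x) * indicator ?B y \<partial>?\<nu>)
        = (\<integral>\<^sup>+y. indicator A y * indicator ?B (y - x) \<partial>?\<nu>)" .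
  qed
  also have "\<dots> = (\<integral>\<^sup>+y. (\<integral>\<^sup>+x. indicator A y * indicator ?B (y - x) \<partial>lborel) \<partial>?\<nu>)"
    by (rule Fubini'[symmetric]) measurable
  also have "\<dots> = (\<integral>\<^sup>+y. indicator A y * emeasure lborel ?B \<partial>?\<nu>)"
  proof (intro nn_integral_cong)
    fix y
    have "(\<integral>\<^sup>+x. indicator A y * indicator ?B (y - x) \<partial>lborel)
        = indicator A y * (\<integral>\<^sup>+x. indicator ?B (- y + x) \<partial>lborel)"
      by (subst nn_integral_cmult[symmetric])
        (auto intro!: nn_integral_cong simp: indicator_def norm_minus_commute)
    also have "(\<integral>\<^sup>+x. indicator ?B (- y + x) \<partial>lborel) = emeasure lborel ?B"
      by (subst shift_lborel) auto
    finally show "(\<integral>\<^sup>+x. indicator A y * indicator ?B (y - x) \<partial>lborel)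
        = indicator A y * emeasure lborel ?B" .
  qed
  also have "\<dots> = emeasure ?\<nu> A * emeasure lborel ?B"
    by (simp add: nn_integral_multc)
  finally have "emeasure lborel A * emeasure lborel ?B = emeasure ?\<nu> A * emeasure lborel ?B"
    by (simp add: ball_eq)
  moreover have "emeasure lborel ?B \<noteq> 0"
    using content_ball_pos[of 1 "0::'a"]
    by (auto simp: measure_def)
  moreover have "emeasure lborel ?B \<noteq> \<top>"
    using emeasure_lborel_ball_finite[of "0::'a" 1] by simp
  ultimately show "emeasure ?\<nu> A = emeasure lborel A"
    by (simp add: mult.commute[of _ "emeasure lborel ?B"] ennreal_mult_cancel_left)
qed

lemma nn_integral_lborel_prod_cart:
  fixes f :: "'n::finite \<Rightarrow> real \<Rightarrow> ennreal"
  assumes [measurable]: "\<And>i. f i \<in> borel_measurable borel"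
  shows "(\<integral>\<^sup>+z. (\<Prod>i\<in>UNIV. f i ((z::real^'n) $ i)) \<partial>lborel) = (\<Prod>i\<in>UNIV. \<integral>\<^sup>+t. f i t \<partial>lborel)"
proof -
  let ?e = "\<lambda>i::'n. axis i 1 :: real^'n"
  have inj: "inj ?e" by (auto simp: inj_on_def axis_eq_axis)
  have Basis: "(Basis :: (real^'n) set) = range ?e" by (auto simp: Basis_vec_def)
  define g where "g b = f (inv ?e b)" for b
  have g: "g (?e i) = f i" for i by (simp add: g_def inv_f_f[OF inj])
  have "(\<integral>\<^sup>+z. (\<Prod>b\<in>Basis. g b ((z::real^'n) \<bullet> b)) \<partial>lborel) = (\<Prod>b\<in>Basis. \<integral>\<^sup>+t. g b t \<partial>lborel)"
    by (rule nn_integral_lborel_prod) (auto simp: g_def)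
  then show ?thesis
    unfolding Basis by (simp add: prod.reindex[OF inj] g inner_axis)
qed

lemma sets_std_normal [simp, measurable_cong]: "sets std_normal = sets borel"
  by (simp add: std_normal_def)

lemma space_std_normal [simp]: "space std_normal = UNIV"
  by (simp add: std_normal_def)

lemma nn_integral_std_normal_density: "(\<integral>\<^sup>+t. ennreal (std_normal_density t) \<partial>lborel) = 1"
  using std_normal_moment_even[of 0]
  by (subst nn_integral_eq_integral) (auto simp: has_bochner_integral_iff)

lemma nn_integral_std_normal:
  fixes f :: "real^'n \<Rightarrow> ennreal"
  assumes [measurable]: "f \<in> borel_measurable borel"
  shows "(\<integral>\<^sup>+z. f z \<partial>std_normal)
    = (\<integral>\<^sup>+z. (\<Prod>i\<in>UNIV. ennreal (std_normal_density (z $ i))) * f z \<partial>lborel)"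
  unfolding std_normal_def by (subst nn_integral_density) (auto simp: prod_ennreal)

lemma prob_space_std_normal: "prob_space (std_normal :: (real^'n) measure)"
proof
  have "emeasure (std_normal :: (real^'n) measure) (space std_normal)
      = (\<integral>\<^sup>+z. 1 \<partial>(std_normal :: (real^'n) measure))" by simp
  also have "\<dots> = (\<integral>\<^sup>+z. (\<Prod>i\<in>UNIV. ennreal (std_normal_density ((z::real^'n) $ i))) \<partial>lborel)"
    by (simp only: nn_integral_std_normal borel_measurable_const mult_1_right)
  also have "\<dots> = 1"
    by (subst nn_integral_lborel_prod_cart) (auto simp: nn_integral_std_normal_density)
  finally show "emeasure (std_normal :: (real^'n) measure) (space std_normal) = 1" .
qed

text \<open>The density depends on the norm of its argument alone.\<close>

lemma distr_std_normal_orthogonal_transformation: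
  fixes f :: "real^'n \<Rightarrow> real^'n"
  assumes f: "orthogonal_transformation f"
  shows "distr std_normal borel f = std_normal"
proof (rule measure_eqI)
  have lin: "linear f" using f by (rule orthogonal_transformation_linear)
  have [measurable]: "f \<in> borel_measurable borel"
    using lin by (rule linear_borel_measurable)
  define g where "g z = (\<Prod>i\<in>UNIV. ennreal (std_normal_density (z $ i)))" for z :: "real^'n"
  have [measurable]: "g \<in> borel_measurable borel" unfolding g_def by measurable
  have "g z = ennreal ((1 / sqrt (2 * pi)) ^ CARD('n) * exp (- (norm z)\<^sup>2 / 2))" for z
  proof -
    have "(\<Prod>i\<in>UNIV. std_normal_density (z $ i))
        = (1 / sqrt (2 * pi)) ^ CARD('n) * exp (\<Sum>i\<in>UNIV. - (z $ i)\<^sup>2 / 2)"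
      by (simp only: std_normal_density_def prod.distrib prod_constant exp_sum[OF finite])
    also have "(\<Sum>i\<in>UNIV. - (z $ i)\<^sup>2 / 2) = - (norm z)\<^sup>2 / 2"
      by (simp add: norm_vec_def L2_set_def sum_nonneg sum_negf flip: sum_divide_distrib)
    finally show ?thesis by (simp add: g_def prod_ennreal)
  qed
  then have gf: "g (f z) = g z" for z
    using f by (simp add: orthogonal_transformation)
  show "sets (distr std_normal borel f) = sets std_normal" by simp
  fix A assume "A \<in> sets (distr std_normal borel f)"
  then have [measurable]: "A \<in> sets borel" by simp
  have "emeasure (distr std_normal borel f) A = (\<integral>\<^sup>+z. indicator A (f z) \<partial>std_normal)"
    by (subst nn_integral_distr[symmetric, where f = "indicator A" and M' = borel]) auto
  also have "\<dots> = (\<integral>\<^sup>+z. g (f z) * indicator A (f z) \<partial>lborel)"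
    by (simp only: gf) (subst nn_integral_std_normal, auto simp: g_def)
  also have "\<dots> = (\<integral>\<^sup>+z. g z * indicator A z \<partial>distr lborel borel f)"
    by (subst nn_integral_distr) auto
  also have "\<dots> = (\<integral>\<^sup>+z. indicator A z \<partial>std_normal)"
    unfolding distr_lborel_orthogonal_transformation[OF f]
    by (subst nn_integral_std_normal) (auto simp: g_def)
  finally show "emeasure (distr std_normal borel f) A = emeasure std_normal A" by simp
qed

lemma std_normal_second_moment:
  fixes k :: "'n::finite"
  shows "has_bochner_integral std_normal (\<lambda>z::real^'n. (z $ k)\<^sup>2) 1"
proof (rule has_bochner_integral_nn_integral)
  have mom: "(\<integral>\<^sup>+t. ennreal (std_normal_density t * t\<^sup>2) \<partial>lborel) = 1"
    using std_normal_moment_even[of 1]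
    by (subst nn_integral_eq_integral) (auto simp: has_bochner_integral_iff)
  have "(\<integral>\<^sup>+z. ennreal ((z $ k)\<^sup>2) \<partial>(std_normal :: (real^'n) measure))
      = (\<integral>\<^sup>+z. (\<Prod>i\<in>UNIV. (if i = k then ennreal (std_normal_density ((z::real^'n) $ i) * (z $ i)\<^sup>2)
          else ennreal (std_normal_density (z $ i)))) \<partial>lborel)"
    by (subst nn_integral_std_normal)
      (auto intro!: nn_integral_cong simp: ennreal_mult prod.If_cases prod.remove[of UNIV k] Compl_eq_Diff_UNIV mult_ac)
  also have "\<dots> = (\<Prod>i\<in>UNIV. \<integral>\<^sup>+t. (if i = k then ennreal (std_normal_density t * t\<^sup>2)
          else ennreal (std_normal_density t)) \<partial>lborel)"
    by (subst nn_integral_lborel_prod_cart[where f = "\<lambda>i t. if i = k then ennreal (std_normal_density t * t\<^sup>2)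
          else ennreal (std_normal_density t)"]) auto
  also have "\<dots> = 1"
  proof (intro prod.neutral ballI)
    fix i
    show "(\<integral>\<^sup>+t. (if i = k then ennreal (std_normal_density t * t\<^sup>2)
          else ennreal (std_normal_density t)) \<partial>lborel) = 1"
      by (cases "i = k") (simp_all add: mom nn_integral_std_normal_density)
  qed
  finally show "(\<integral>\<^sup>+z. ennreal ((z $ k)\<^sup>2) \<partial>(std_normal :: (real^'n) measure)) = ennreal 1" by simp
qed auto

lemma integrable_std_normal_square: "integrable std_normal (\<lambda>z::real^'n. (z $ k)\<^sup>2)"
  using std_normal_second_moment[of k] by (simp add: has_bochner_integral_iff)

text \<open>Reflection in a coordinate hyperplane is orthogonal. This gives the vanishing first moments and
  the vanishing mixed second moments.\<close>

lemma std_normal_odd_integral: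
  fixes h :: "real^'n \<Rightarrow> real"
  assumes [measurable]: "h \<in> borel_measurable borel"
    and odd: "\<And>z. h (\<chi> j. if j = k then - z $ j else z $ j) = - h z"
  shows "(\<integral>z. h z \<partial>std_normal) = 0"
proof -
  let ?f = "\<lambda>z::real^'n. \<chi> j. if j = k then - z $ j else z $ j"
  have "linear ?f" by (rule linearI) (auto simp: vec_eq_iff)
  moreover have "?f v \<bullet> ?f w = v \<bullet> w" for v w
    by (auto simp: inner_vec_def intro!: sum.cong)
  ultimately have f: "orthogonal_transformation ?f"
    by (simp add: orthogonal_transformation_def)
  have [measurable]: "?f \<in> borel_measurable borel"
    using \<open>linear ?f\<close> by (rule linear_borel_measurable)
  have "(\<integral>z. h z \<partial>std_normal) = (\<integral>z. h (?f z) \<partial>std_normal)"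
    by (subst (1) distr_std_normal_orthogonal_transformation[OF f, symmetric])
      (subst integral_distr, auto)
  then show ?thesis by (simp add: odd)
qed

lemma integrable_std_normal_mult:
  fixes i j :: "'n::finite"
  shows "integrable std_normal (\<lambda>z::real^'n. z $ i * z $ j)"
proof (rule Bochner_Integration.integrable_bound)
  show "integrable std_normal (\<lambda>z::real^'n. (z $ i)\<^sup>2 + (z $ j)\<^sup>2)"
    by (intro Bochner_Integration.integrable_add integrable_std_normal_square)
  have "\<bar>a * b\<bar> \<le> a\<^sup>2 + b\<^sup>2" for a b :: real
  proof -
    have "2 * (\<bar>a\<bar> * \<bar>b\<bar>) \<le> a\<^sup>2 + b\<^sup>2" using sum_squares_bound[of "\<bar>a\<bar>" "\<bar>b\<bar>"] by simp
    moreover have "0 \<le> \<bar>a\<bar> * \<bar>b\<bar>" by simp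
    ultimately show ?thesis unfolding abs_mult by linarith
  qed
  then show "AE z in std_normal. norm (z $ i * z $ j) \<le> norm ((z $ i)\<^sup>2 + (z $ j)\<^sup>2)"
    by simp
qed auto

lemma integrable_std_normal_component:
  "integrable std_normal (\<lambda>z::real^'n. z $ i)"
proof (rule Bochner_Integration.integrable_bound)
  show "integrable std_normal (\<lambda>z::real^'n. 1 + (z $ i)\<^sup>2)"
    by (intro Bochner_Integration.integrable_add integrable_std_normal_square
        finite_measure.integrable_const prob_space.finite_measure prob_space_std_normal)
  have "\<bar>a\<bar> \<le> 1 + a\<^sup>2" for a :: real
    using sum_squares_bound[of 1 "\<bar>a\<bar>"] by simp
  then show "AE z in std_normal. norm (z $ i) \<le> norm (1 + (z $ i)\<^sup>2)"
    by simp
qed auto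

lemma std_normal_linear:
  "has_bochner_integral std_normal (\<lambda>z::real^'n. v \<bullet> z) 0"
proof -
  have "(\<integral>z. (z::real^'n) $ i \<partial>std_normal) = 0" for i
    by (rule std_normal_odd_integral[where k = i]) auto
  then have "has_bochner_integral std_normal (\<lambda>z::real^'n. \<Sum>i\<in>UNIV. v $ i * z $ i) (\<Sum>i\<in>(UNIV::'n set). v $ i * 0)"
    by (intro has_bochner_integral_sum has_bochner_integral_mult_right)
      (simp add: has_bochner_integral_iff integrable_std_normal_component)
  then show ?thesis by (simp add: inner_vec_def)
qed

lemma std_normal_quadratic:
  fixes M :: "real^'n^'n"
  shows "has_bochner_integral std_normal (\<lambda>z. z \<bullet> (M *v z)) (trace M)"
proof -
  have m: "has_bochner_integral std_normal (\<lambda>z::real^'n. z $ i * z $ j) (if i = j then 1 else 0)" for i j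
  proof (cases "i = j")
    case True
    then show ?thesis using std_normal_second_moment[of i] by (simp add: power2_eq_square)
  next
    case False
    have "(\<integral>z. (z::real^'n) $ i * z $ j \<partial>std_normal) = 0"
      by (rule std_normal_odd_integral[where k = i]) (use False in auto)
    then show ?thesis using False integrable_std_normal_mult by (simp add: has_bochner_integral_iff)
  qed
  have "has_bochner_integral std_normal (\<lambda>z::real^'n. \<Sum>i\<in>UNIV. \<Sum>j\<in>UNIV. M $ i $ j * (z $ i * z $ j))
      (\<Sum>i\<in>UNIV. \<Sum>j\<in>UNIV. M $ i $ j * (if i = j then 1 else 0))"
    by (intro has_bochner_integral_sum has_bochner_integral_mult_right m)
  also have "(\<Sum>i\<in>UNIV. \<Sum>j\<in>UNIV. M $ i $ j * (if i = j then 1 else 0)) = trace M"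
    by (simp add: trace_def if_distrib cong: if_cong)
  also have "(\<lambda>z::real^'n. \<Sum>i\<in>UNIV. \<Sum>j\<in>UNIV. M $ i $ j * (z $ i * z $ j)) = (\<lambda>z. z \<bullet> (M *v z))"
    by (simp add: fun_eq_iff inner_vec_def matrix_vector_mult_def sum_distrib_left mult_ac)
  finally show ?thesis .
qed

lemma std_normal_affine_quadratic:
  fixes X B :: "real^'n^'n"
  assumes sym: "transpose X = X"
  shows "has_bochner_integral std_normal (\<lambda>z. (m + B *v z) \<bullet> (X *v (m + B *v z)))
    (m \<bullet> (X *v m) + B \<bullet> (X ** B))"
proof -
  have eq: "(m + B *v z) \<bullet> (X *v (m + B *v z)) = m \<bullet> (X *v m)
      + (2 * (((transpose B ** X) *v m) \<bullet> z) + z \<bullet> ((transpose B ** (X ** B)) *v z))" for z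
  proof -
    have "z \<bullet> ((transpose B ** (X ** B)) *v z) = (B *v z) \<bullet> (X *v (B *v z))"
      by (metis dot_lmul_matrix inner_commute matrix_vector_mul_assoc transpose_matrix_vector)
    moreover have "((transpose B ** X) *v m) \<bullet> z = (X *v m) \<bullet> (B *v z)"
      by (metis dot_lmul_matrix matrix_vector_mul_assoc transpose_matrix_vector)
    moreover have "m \<bullet> (X *v (B *v z)) = (X *v m) \<bullet> (B *v z)"
      by (rule inner_matrix_vector_symmetric[OF sym])
    moreover have "(B *v z) \<bullet> (X *v m) = (X *v m) \<bullet> (B *v z)" by (rule inner_commute)
    ultimately show ?thesis
      unfolding matrix_vector_right_distrib inner_add_left inner_add_right by linarith
  qed
  have const: "has_bochner_integral (std_normal :: (real^'n) measure) (\<lambda>z. m \<bullet> (X *v m)) (m \<bullet> (X *v m))"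
  proof -
    interpret prob_space "std_normal :: (real^'n) measure" by (rule prob_space_std_normal)
    show ?thesis using prob_space by (simp add: has_bochner_integral_iff)
  qed
  have "has_bochner_integral std_normal (\<lambda>z. m \<bullet> (X *v m)
      + (2 * (((transpose B ** X) *v m) \<bullet> z) + z \<bullet> ((transpose B ** (X ** B)) *v z)))
      (m \<bullet> (X *v m) + (2 * 0 + trace (transpose B ** (X ** B))))"
    by (intro has_bochner_integral_add has_bochner_integral_mult_right const
        std_normal_linear std_normal_quadratic)
  then show ?thesis by (simp add: eq inner_matrix_trace)
qed

text \<open>By polar decomposition, \<open>B = R ** U\<close> with \<open>R\<close> the square root of \<open>B ** transpose B\<close> and \<open>U\<close>
  orthogonal, and \<open>U\<close> preserves the standard normal law. Invertibility of \<open>B\<close> allows the choice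
  \<open>U = matrix_inv R ** B\<close>.\<close>

lemma distr_std_normal_invertible:
  fixes B :: "real^'n^'n"
  assumes inv: "invertible B"
  shows "distr std_normal borel (\<lambda>z. \<mu> + B *v z) = normal \<mu> (B ** transpose B)"
    and "psd (B ** transpose B)"
proof -
  let ?S = "B ** transpose B"
  have "transpose ?S = ?S" by (simp add: matrix_transpose_mul)
  moreover have "x \<bullet> (?S *v x) = (transpose B *v x) \<bullet> (transpose B *v x)" for x
    by (metis dot_lmul_matrix matrix_vector_mul_assoc transpose_matrix_vector)
  ultimately show psd: "psd ?S" by (simp add: psd_def)
  define R where "R = psd_sqrt ?S"
  have R: "transpose R = R" "R ** R = ?S"
    using psd_sqrt[OF psd] by (auto simp: R_def psd_def)
  have "det R * det R = det B * det B"
    using arg_cong[OF R(2), of det] by (simp add: det_mul)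
  then have "invertible R" using inv by (auto simp: invertible_det_nz)
  define V where "V = matrix_inv R"
  have V: "R ** V = mat 1" "V ** R = mat 1"
    using matrix_inv_inverse[OF \<open>invertible R\<close>] by (auto simp: V_def)
  have tV: "R ** transpose V = mat 1"
    using arg_cong[OF V(2), of transpose] by (simp add: matrix_transpose_mul R(1))
  define U where "U = V ** B"
  have "U ** transpose U = V ** ?S ** transpose V"
    by (simp add: U_def matrix_transpose_mul matrix_mul_assoc)
  also have "\<dots> = (V ** R) ** (R ** transpose V)"
    by (simp add: matrix_mul_assoc flip: R(2))
  finally have "U ** transpose U = mat 1" by (simp add: V tV)
  then have "orthogonal_matrix U"
    by (metis matrix_left_right_inverse orthogonal_matrix)
  then have U: "orthogonal_transformation ((*v) U)"
    by (simp add: orthogonal_transformation_matrix)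
  have RU: "R *v (U *v z) = B *v z" for z
    by (simp add: U_def matrix_vector_mul_assoc matrix_mul_assoc V)
  have "normal \<mu> ?S = distr (distr std_normal borel ((*v) U)) borel (\<lambda>z. \<mu> + R *v z)"
    by (simp add: normal_def R_def distr_std_normal_orthogonal_transformation[OF U])
  also have "\<dots> = distr std_normal borel (\<lambda>z. \<mu> + B *v z)"
    by (subst distr_distr) (auto simp: comp_def RU)
  finally show "distr std_normal borel (\<lambda>z. \<mu> + B *v z) = normal \<mu> ?S" by simp
qed

section \<open>Trust-region problems\<close>

text \<open>Let \<open>b\<close> maximize the form over the ball and put \<open>d = b - a\<close>. Strict convexity puts \<open>b\<close> on the
  sphere, so every reflection of \<open>d\<close> stays feasible. Comparing \<open>b\<close> with the reflection in the
  hyperplane orthogonal to \<open>u\<close> gives \<open>(d \<bullet> u) * (u \<bullet> L u) \<le> (u \<bullet> L b) * (u \<bullet> u)\<close> when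
  \<open>d \<bullet> u > 0\<close>. Letting \<open>u\<close> approach the hyperplane orthogonal to \<open>d\<close> shows that \<open>L b\<close> is a multiple
  \<open>\<gamma> *\<^sub>R d\<close>, and then the same inequality says that \<open>\<gamma>\<close> dominates \<open>L\<close>. With this multiplier the
  Lagrangian is concave and stationary at \<open>b\<close>, which gives the second conclusion.\<close>

lemma trust_region_strong_duality:
  fixes L :: "'a::euclidean_space \<Rightarrow> 'a"
  assumes lin: "linear L" and sym: "\<And>x y. x \<bullet> L y = L x \<bullet> y"
    and pos: "\<And>x. x \<noteq> 0 \<Longrightarrow> 0 < x \<bullet> L x" and \<rho>: "\<rho> > 0"
    and b: "b \<in> cball a \<rho>" and max: "\<And>c. c \<in> cball a \<rho> \<Longrightarrow> c \<bullet> L c \<le> b \<bullet> L b"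
  obtains \<gamma> where "\<And>u. u \<bullet> L u \<le> \<gamma> * (u \<bullet> u)"
    "\<And>c. c \<bullet> L c + \<gamma> * (\<rho>\<^sup>2 - (norm (c - a))\<^sup>2) \<le> b \<bullet> L b"
proof -
  define q where "q x = x \<bullet> L x" for x
  define d where "d = b - a"
  have q_add: "q (x + y) = q x + 2 * (y \<bullet> L x) + q y" for x y
    using sym[of x y] by (simp add: q_def linear_add[OF lin] inner_add_left inner_add_right inner_commute)
  have q_scale: "q (t *\<^sub>R x) = t\<^sup>2 * q x" for t x
    by (simp add: q_def linear_cmul[OF lin] power2_eq_square)
  have q_nonneg: "q x \<ge> 0" for x
    using pos[of x] linear_0[OF lin] by (cases "x = 0") (auto simp: q_def)
  have qmax: "q (b + e) \<le> q b" if "norm (d + e) \<le> \<rho>" for e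
    using max[of "b + e"] that by (simp add: q_def d_def dist_norm norm_minus_commute algebra_simps)
  have dle: "norm d \<le> \<rho>" using b by (simp add: d_def dist_norm norm_minus_commute)
  have nd: "norm d = \<rho>"
  proof (rule ccontr)
    assume "norm d \<noteq> \<rho>"
    with dle have lt: "norm d < \<rho>" by simp
    obtain u :: 'a where u: "norm u = 1" using vector_choose_size[of 1] by auto
    define v where "v = (if u \<bullet> L b \<ge> 0 then u else - u)"
    have v: "norm v = 1" "v \<bullet> L b \<ge> 0" using u by (auto simp: v_def)
    let ?t = "\<rho> - norm d"
    have "norm (d + ?t *\<^sub>R v) \<le> \<rho>"
      using norm_triangle_ineq[of d "?t *\<^sub>R v"] v(1) lt by simp
    then have "2 * ((?t *\<^sub>R v) \<bullet> L b) + q (?t *\<^sub>R v) \<le> 0"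
      using qmax[of "?t *\<^sub>R v"] by (simp add: q_add)
    moreover have "(?t *\<^sub>R v) \<bullet> L b \<ge> 0" using v(2) lt by simp
    moreover have "q (?t *\<^sub>R v) > 0" unfolding q_def by (rule pos) (use v(1) lt in auto)
    ultimately show False by linarith
  qed
  have dd: "d \<bullet> d = \<rho>\<^sup>2" using nd by (simp flip: power2_norm_eq_inner)
  have reflect: "(d \<bullet> u) * q u \<le> (u \<bullet> L b) * (u \<bullet> u)" if du: "d \<bullet> u > 0" for u
  proof -
    have uu: "u \<bullet> u > 0" using du by (cases "u = 0") auto
    \<comment> \<open>For this \<open>t\<close>, the vector \<open>d - t u\<close> is the mirror image of \<open>d\<close>.\<close>
    define t where "t = 2 * (d \<bullet> u) / (u \<bullet> u)"
    have tp: "t > 0" using du uu by (simp add: t_def)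
    have "(norm (d + (- t) *\<^sub>R u))\<^sup>2 = d \<bullet> d - 2 * t * (d \<bullet> u) + t\<^sup>2 * (u \<bullet> u)"
      unfolding power2_norm_eq_inner
      by (simp add: inner_diff_left inner_diff_right inner_commute power2_eq_square algebra_simps)
    also have "\<dots> = d \<bullet> d" using uu by (simp add: t_def power2_eq_square)
    finally have "norm (d + (- t) *\<^sub>R u) = \<rho>"
      using \<rho> dd by (simp add: power2_eq_iff_nonneg)
    then have "q (b + (- t) *\<^sub>R u) \<le> q b" by (intro qmax) simp
    then have "t * (t * q u) \<le> t * (2 * (u \<bullet> L b))"
      unfolding q_add q_scale by (simp add: power2_eq_square)
    then have "t * q u \<le> 2 * (u \<bullet> L b)" using tp by simp
    then have "t * q u * (u \<bullet> u) \<le> 2 * (u \<bullet> L b) * (u \<bullet> u)"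
      using uu by (intro mult_right_mono) auto
    then show ?thesis using uu by (simp add: t_def)
  qed
  have half: "0 \<le> u \<bullet> L b" if du: "d \<bullet> u \<ge> 0" for u
  proof (rule field_le_epsilon)
    fix e :: real assume e: "e > 0"
    define s where "s = e / (\<bar>d \<bullet> L b\<bar> + 1)"
    have s: "s > 0" using e by (simp add: s_def)
    have "d \<bullet> (u + s *\<^sub>R d) = d \<bullet> u + s * \<rho>\<^sup>2" by (simp add: inner_add_right dd)
    then have p: "d \<bullet> (u + s *\<^sub>R d) > 0" using du s \<rho> by (simp add: add_nonneg_pos)
    then have "0 \<le> ((u + s *\<^sub>R d) \<bullet> L b) * ((u + s *\<^sub>R d) \<bullet> (u + s *\<^sub>R d))"
      using reflect[OF p] q_nonneg by (meson less_imp_le mult_nonneg_nonneg order_trans)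
    moreover have "(u + s *\<^sub>R d) \<bullet> (u + s *\<^sub>R d) > 0"
      using p by (metis inner_gt_zero_iff inner_zero_right less_irrefl)
    ultimately have "0 \<le> (u + s *\<^sub>R d) \<bullet> L b" by (simp add: zero_le_mult_iff)
    then have "0 \<le> u \<bullet> L b + s * (d \<bullet> L b)" by (simp add: inner_add_left)
    also have "s * (d \<bullet> L b) \<le> s * (\<bar>d \<bullet> L b\<bar> + 1)" using s by (intro mult_left_mono) auto
    also have "\<dots> = e" by (simp add: s_def)
    finally show "0 \<le> u \<bullet> L b + e" by simp
  qed
  define \<gamma> where "\<gamma> = (d \<bullet> L b) / \<rho>\<^sup>2"
  have stationary: "L b = \<gamma> *\<^sub>R d"
  proof -
    define w where "w = L b - \<gamma> *\<^sub>R d"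
    have dw: "d \<bullet> w = 0" using \<rho> dd by (simp add: w_def \<gamma>_def inner_diff_right)
    then have "w \<bullet> L b = 0" using half[of w] half[of "- w"] by simp
    then have "w \<bullet> w = 0"
      using dw by (subst (2) w_def) (simp add: inner_diff_right inner_commute)
    then show ?thesis by (simp add: w_def)
  qed
  have curv: "q u \<le> \<gamma> * (u \<bullet> u)" for u
  proof -
    have pos': "q u \<le> \<gamma> * (u \<bullet> u)" if du: "d \<bullet> u > 0" for u
    proof -
      have "(d \<bullet> u) * q u \<le> (d \<bullet> u) * (\<gamma> * (u \<bullet> u))"
        using reflect[OF du] by (simp add: stationary inner_commute ac_simps)
      then show ?thesis using du by simp
    qed
    have nz: "q u \<le> \<gamma> * (u \<bullet> u)" if "d \<bullet> u \<noteq> 0" for u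
      using pos'[of u] pos'[of "- u"] that q_scale[of "-1" u] by (cases "d \<bullet> u > 0") auto
    show ?thesis
    proof (cases "d \<bullet> u = 0")
      case True
      \<comment> \<open>Average the two inequalities for \<open>u + s d\<close> and \<open>u - s d\<close> and let \<open>s\<close> tend to 0.\<close>
      define K where "K = \<gamma> * \<rho>\<^sup>2 - q d"
      have K: "K \<ge> 0" using nz[of d] dd \<rho> by (simp add: K_def)
      show ?thesis
      proof (rule field_le_epsilon)
        fix e :: real assume e: "e > 0"
        define s where "s = sqrt (e / (K + 1))"
        have s: "s > 0" "s\<^sup>2 = e / (K + 1)" using e K by (auto simp: s_def)
        have 1: "q u + 2 * (r * (d \<bullet> L u)) + r\<^sup>2 * q d \<le> \<gamma> * (u \<bullet> u) + \<gamma> * (r\<^sup>2 * \<rho>\<^sup>2)" if "r \<noteq> 0" for r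
        proof -
          have "d \<bullet> (u + r *\<^sub>R d) \<noteq> 0" using that True dd \<rho> by (simp add: inner_add_right)
          from nz[OF this] have "q (u + r *\<^sub>R d) \<le> \<gamma> * ((u + r *\<^sub>R d) \<bullet> (u + r *\<^sub>R d))" .
          also have "(u + r *\<^sub>R d) \<bullet> (u + r *\<^sub>R d) = u \<bullet> u + r\<^sup>2 * \<rho>\<^sup>2"
            using True dd by (simp add: inner_add_left inner_add_right inner_commute power2_eq_square)
          finally show ?thesis by (simp add: q_add q_scale distrib_left)
        qed
        have "q u \<le> \<gamma> * (u \<bullet> u) + s\<^sup>2 * K"
          using 1[of s] 1[of "- s"] s(1) by (simp add: K_def algebra_simps)
        also have "s\<^sup>2 * K \<le> s\<^sup>2 * (K + 1)" by (intro mult_left_mono) auto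
        also have "\<dots> = e" using K by (simp add: s(2))
        finally show "q u \<le> \<gamma> * (u \<bullet> u) + e" by simp
      qed
    qed (rule nz)
  qed
  show thesis
  proof
    show "u \<bullet> L u \<le> \<gamma> * (u \<bullet> u)" for u using curv[of u] by (simp add: q_def)
    fix c
    define e where "e = c - b"
    have c: "c = b + e" "c - a = d + e" by (auto simp: e_def d_def)
    have "(norm (c - a))\<^sup>2 = \<rho>\<^sup>2 + 2 * (e \<bullet> d) + e \<bullet> e"
      unfolding c(2) power2_norm_eq_inner
      by (simp add: inner_add_left inner_add_right inner_commute dd)
    then have "q c + \<gamma> * (\<rho>\<^sup>2 - (norm (c - a))\<^sup>2) = q b + (q e - \<gamma> * (e \<bullet> e))"
      unfolding c(1) by (simp add: q_add stationary algebra_simps)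
    also have "\<dots> \<le> q b" using curv[of e] by simp
    finally show "c \<bullet> L c + \<gamma> * (\<rho>\<^sup>2 - (norm (c - a))\<^sup>2) \<le> b \<bullet> L b" by (simp add: q_def)
  qed
qed

definition ball_max :: "real \<Rightarrow> real^'n^'n \<Rightarrow> real^'n^'n \<Rightarrow> real" where
  "ball_max \<rho> X A = (SUP B\<in>cball A \<rho>. B \<bullet> (X ** B))"

lemma continuous_on_matrix_quadratic:
  fixes X :: "real^'n^'n"
  shows "continuous_on S (\<lambda>B. B \<bullet> (X ** B))"
  using linear_matrix_mult_left[of X]
  by (intro continuous_intros linear_continuous_on) (simp add: linear_linear)

lemma ball_max_attained:
  fixes X A :: "real^'n^'n"
  assumes "\<rho> > 0"
  obtains B where "B \<in> cball A \<rho>" "ball_max \<rho> X A = B \<bullet> (X ** B)"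
    "\<And>C. C \<in> cball A \<rho> \<Longrightarrow> C \<bullet> (X ** C) \<le> B \<bullet> (X ** B)"
proof -
  obtain B where B: "B \<in> cball A \<rho>" "\<And>C. C \<in> cball A \<rho> \<Longrightarrow> C \<bullet> (X ** C) \<le> B \<bullet> (X ** B)"
    using continuous_attains_sup[OF compact_cball _ continuous_on_matrix_quadratic, of A \<rho> X] assms
    by auto
  moreover have "ball_max \<rho> X A = B \<bullet> (X ** B)"
    unfolding ball_max_def using B by (intro cSup_eq_maximum) auto
  ultimately show thesis using that by blast
qed

lemma ball_max_upper:
  fixes X A :: "real^'n^'n"
  assumes "\<rho> > 0" "B \<in> cball A \<rho>"
  shows "B \<bullet> (X ** B) \<le> ball_max \<rho> X A"
  using ball_max_attained[OF assms(1), of A X] assms(2) by metis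

text \<open>The law of \<open>\<mu> + B z\<close> is identified as a normal law for invertible \<open>B\<close>; by density, these matrices
  determine the maximum.\<close>

lemma ball_max_le_invertible:
  fixes X A :: "real^'n^'n"
  assumes "\<rho> > 0"
    and le: "\<And>B. invertible B \<Longrightarrow> B \<in> cball A \<rho> \<Longrightarrow> B \<bullet> (X ** B) \<le> c"
  shows "ball_max \<rho> X A \<le> c"
proof -
  let ?S = "{B. B \<bullet> (X ** B) \<le> c}"
  have "closed ?S"
    by (intro closed_Collect_le continuous_on_matrix_quadratic continuous_on_const)
  moreover have "ball A \<rho> \<inter> {B. invertible B} \<subseteq> ?S"
    using le by auto
  ultimately have "closure (ball A \<rho> \<inter> {B. invertible B}) \<subseteq> ?S" by (intro closure_minimal)
  moreover have "ball A \<rho> \<subseteq> closure (ball A \<rho> \<inter> {B. invertible B})"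
    using open_Int_closure_subset[of "ball A \<rho>" "{B. invertible B}"]
    by (simp add: closure_invertible_matrices)
  ultimately have "ball A \<rho> \<subseteq> ?S" by (rule order_trans[rotated])
  then have "closure (ball A \<rho>) \<subseteq> ?S"
    using \<open>closed ?S\<close> by (rule closure_minimal)
  then have "cball A \<rho> \<subseteq> ?S" using assms(1) by simp
  then show ?thesis using ball_max_attained[OF assms(1), of A X] by (metis mem_Collect_eq subsetD)
qed

text \<open>The part of the dual objective that depends on \<open>\<gamma>\<close>, in terms of the square root \<open>A\<close> of the
  covariance matrix (see \<open>dual_value_psd_sqrt\<close> for the covariance form).\<close>

definition dual_value :: "real \<Rightarrow> real^'n^'n \<Rightarrow> real^'n^'n \<Rightarrow> real \<Rightarrow> real" where
  "dual_value \<rho> X A \<gamma> =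
     \<gamma> * (\<rho>\<^sup>2 - (norm A)\<^sup>2) + \<gamma>\<^sup>2 * (A \<bullet> (matrix_inv (mat \<gamma> - X) ** A))"

lemma dual_value_upper:
  fixes X A :: "real^'n^'n"
  assumes "\<rho> > 0" "pos_def X" "pos_def (mat \<gamma> - X)"
  shows "ball_max \<rho> X A \<le> dual_value \<rho> X A \<gamma>"
proof -
  obtain B where B: "B \<in> cball A \<rho>" "ball_max \<rho> X A = B \<bullet> (X ** B)"
    using ball_max_attained[OF assms(1)] by metis
  have "(norm (B - A))\<^sup>2 \<le> \<rho>\<^sup>2"
    using B(1) by (intro power_mono) (auto simp: dist_norm norm_minus_commute)
  then have "\<gamma> * (norm (B - A))\<^sup>2 \<le> \<gamma> * \<rho>\<^sup>2"
    using pos_def_mat_diff_imp_pos[OF assms(2,3)] by (intro mult_left_mono) auto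
  then show ?thesis
    using penalized_matrix_quadratic(1)[OF assms(3), of B A]
    by (simp add: B(2) dual_value_def algebra_simps)
qed

text \<open>The multiplier \<open>g\<close> of the trust-region problem may equal the largest eigenvalue of \<open>X\<close>, in which
  case the dual infimum is not attained. Increasing \<open>g\<close> slightly makes it feasible at small cost.\<close>

lemma dual_value_approximates:
  fixes X A :: "real^'n^'n"
  assumes \<rho>: "\<rho> > 0" and X: "pos_def X" and e: "e > 0"
  shows "\<exists>\<gamma>. pos_def (mat \<gamma> - X) \<and> dual_value \<rho> X A \<gamma> \<le> ball_max \<rho> X A + e"
proof -
  have symX: "transpose X = X" using X by (simp add: pos_def_def)
  obtain B where B: "B \<in> cball A \<rho>" "ball_max \<rho> X A = B \<bullet> (X ** B)"
    "\<And>C. C \<in> cball A \<rho> \<Longrightarrow> C \<bullet> (X ** C) \<le> B \<bullet> (X ** B)"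
    using ball_max_attained[OF \<rho>] by metis
  obtain g where g: "\<And>U::real^'n^'n. U \<bullet> (X ** U) \<le> g * (U \<bullet> U)"
    "\<And>C. C \<bullet> (X ** C) + g * (\<rho>\<^sup>2 - (norm (C - A))\<^sup>2) \<le> B \<bullet> (X ** B)"
    using trust_region_strong_duality[OF linear_matrix_mult_left inner_matrix_mult_symmetric[OF symX]
        inner_matrix_mult_pos[OF X] \<rho> B(1,3)] by metis
  define \<gamma> where "\<gamma> = g + e / \<rho>\<^sup>2"
  have e': "e / \<rho>\<^sup>2 > 0" using e \<rho> by simp
  have K: "pos_def (mat \<gamma> - X)"
    unfolding pos_def_def
  proof safe
    show "transpose (mat \<gamma> - X) = mat \<gamma> - X"
      using symX by (simp add: transpose_def vec_eq_iff mat_def)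
    fix u :: "real^'n" assume u: "u \<noteq> 0"
    \<comment> \<open>Testing with the matrix whose columns all equal \<open>u\<close> transfers the bound to vectors.\<close>
    define U :: "real^'n^'n" where "U = (\<chi> i j. u $ i)"
    have "column j U = u" for j by (simp add: U_def column_def vec_eq_iff)
    then have "real CARD('n) * (u \<bullet> (X *v u)) \<le> real CARD('n) * (g * (u \<bullet> u))"
      using g(1)[of U] by (simp add: inner_matrix_columns column_matrix_mult mult_ac)
    then have "u \<bullet> (X *v u) \<le> g * (u \<bullet> u)" by simp
    moreover have "(e / \<rho>\<^sup>2) * (u \<bullet> u) > 0" using e' u by (intro mult_pos_pos) auto
    ultimately show "0 < u \<bullet> ((mat \<gamma> - X) *v u)"
      by (simp add: \<gamma>_def matrix_vector_mult_diff_rdistrib mat_vector_mult inner_diff_right distrib_right)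
  qed
  obtain C where C: "C \<bullet> (X ** C) = \<gamma> * (norm (C - A))\<^sup>2
      + (\<gamma>\<^sup>2 * (A \<bullet> (matrix_inv (mat \<gamma> - X) ** A)) - \<gamma> * (norm A)\<^sup>2)"
    using penalized_matrix_quadratic(2)[OF K] by blast
  have "dual_value \<rho> X A \<gamma> = C \<bullet> (X ** C) + \<gamma> * (\<rho>\<^sup>2 - (norm (C - A))\<^sup>2)"
    unfolding C dual_value_def by (simp add: algebra_simps)
  also have "\<dots> = (C \<bullet> (X ** C) + g * (\<rho>\<^sup>2 - (norm (C - A))\<^sup>2)) + e / \<rho>\<^sup>2 * (\<rho>\<^sup>2 - (norm (C - A))\<^sup>2)"
    by (simp add: \<gamma>_def distrib_right)
  also have "\<dots> \<le> B \<bullet> (X ** B) + e / \<rho>\<^sup>2 * \<rho>\<^sup>2"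
    using e' by (intro add_mono g(2) mult_left_mono) auto
  also have "\<dots> = ball_max \<rho> X A + e" using \<rho> by (simp add: B(2))
  finally show ?thesis using K by blast
qed

section \<open>The worst-case expectation over the ambiguity set\<close>

lemma borel_measurable_quadratic:
  fixes X :: "real^'n^'n"
  shows "(\<lambda>\<xi>. (\<xi> - c) \<bullet> (X *v (\<xi> - c))) \<in> borel_measurable borel"
  unfolding matrix_vector_mult_diff_distrib
  by (intro borel_measurable_continuous_onI continuous_intros linear_continuous_on)

lemma affine_std_normal_quadratic:
  fixes X B :: "real^'n^'n"
  assumes "transpose X = X"
  shows "has_bochner_integral (distr std_normal borel (\<lambda>z. m + B *v z))
    (\<lambda>\<xi>. (\<xi> - c) \<bullet> (X *v (\<xi> - c))) ((m - c) \<bullet> (X *v (m - c)) + B \<bullet> (X ** B))"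
proof -
  note borel_measurable_quadratic [measurable]
  have eq: "m - c + B *v z = m + B *v z - c" for z by simp
  show ?thesis
    using std_normal_affine_quadratic[OF assms, of "m - c" B] unfolding eq
    by (simp add: has_bochner_integral_iff integrable_distr_eq integral_distr)
qed

lemma normal_quadratic:
  fixes X S :: "real^'n^'n"
  assumes "transpose X = X"
  shows "has_bochner_integral (normal m S) (\<lambda>\<xi>. (\<xi> - c) \<bullet> (X *v (\<xi> - c)))
    ((m - c) \<bullet> (X *v (m - c)) + psd_sqrt S \<bullet> (X ** psd_sqrt S))"
  unfolding normal_def by (rule affine_std_normal_quadratic[OF assms])

text \<open>Driving both laws by the same standard normal vector couples them.\<close>

lemma affine_coupling:
  fixes A B :: "real^'n^'n"
  shows "distr std_normal borel (\<lambda>z. (\<mu> + A *v z, \<nu> + B *v z)) \<in> couplings (distr std_normal borel (\<lambda>z. \<mu> + A *v z)) (distr std_normal borel (\<lambda>z. \<nu> + B *v z))"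
proof -
  have [measurable]: "(\<lambda>z. (\<mu> + A *v z, \<nu> + B *v z)) \<in> borel_measurable std_normal"
    by measurable
  have [measurable]: "fst \<in> borel_measurable (borel :: ((real^'n) \<times> (real^'n)) measure)"
    "snd \<in> borel_measurable (borel :: ((real^'n) \<times> (real^'n)) measure)"
    by (intro borel_measurable_continuous_onI continuous_intros)+
  have "prob_space (distr std_normal borel (\<lambda>z. (\<mu> + A *v z, \<nu> + B *v z)))"
    by (intro prob_space.prob_space_distr prob_space_std_normal) measurable
  then show ?thesis
    by (simp add: couplings_def distr_distr comp_def)
qed

lemma wasserstein_affine_le:
  fixes A B :: "real^'n^'n"
  shows "wasserstein (distr std_normal borel (\<lambda>z. \<mu> + A *v z)) (distr std_normal borel (\<lambda>z. \<mu> + B *v z))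
    \<le> norm (A - B)"
proof -
  let ?M = "distr std_normal borel (\<lambda>z. (\<mu> + A *v z, \<mu> + B *v z))"
  have [measurable]: "(\<lambda>\<xi>. (norm (fst \<xi> - snd \<xi>))\<^sup>2) \<in> borel_measurable (borel :: ((real^'n) \<times> (real^'n)) measure)"
    by (intro borel_measurable_continuous_onI continuous_intros)
  have [measurable]: "(\<lambda>z. (\<mu> + A *v z, \<mu> + B *v z)) \<in> borel_measurable std_normal"
    by measurable
  have "wasserstein (distr std_normal borel (\<lambda>z. \<mu> + A *v z)) (distr std_normal borel (\<lambda>z. \<mu> + B *v z))
      \<le> sqrt (\<integral>\<xi>. (norm (fst \<xi> - snd \<xi>))\<^sup>2 \<partial>?M)"
    unfolding wasserstein_def
    by (intro cINF_lower affine_coupling bdd_belowI2[of _ 0]) simp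
  also have "(\<integral>\<xi>. (norm (fst \<xi> - snd \<xi>))\<^sup>2 \<partial>?M)
      = (\<integral>z. (norm (fst (\<mu> + A *v z, \<mu> + B *v z) - snd (\<mu> + A *v z, \<mu> + B *v z)))\<^sup>2 \<partial>std_normal)"
    by (rule integral_distr) measurable
  also have "\<dots> = (\<integral>z. (0 + (A - B) *v z) \<bullet> (mat 1 *v (0 + (A - B) *v z)) \<partial>std_normal)"
    by (simp add: power2_norm_eq_inner matrix_vector_mult_diff_rdistrib)
  also have "\<dots> = (norm (A - B))\<^sup>2"
    using std_normal_affine_quadratic[of "mat 1" 0 "A - B"]
    by (simp add: has_bochner_integral_iff power2_norm_eq_inner)
  finally show ?thesis by simp
qed

text \<open>Integrating the penalized bound along an arbitrary coupling bounds the transport cost from below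
  by \<open>(E - k) / \<gamma>\<close>, where \<open>E\<close> is the expected loss and \<open>k\<close> the expectation of the penalized maximum under
  the nominal law. Being a lower bound for every coupling, it passes to the infimum over couplings.\<close>

lemma ambiguity_weak_duality:
  fixes X \<Sigma> :: "real^'n^'n"
  assumes \<rho>: "\<rho> > 0" and X: "pos_def X" and K: "pos_def (mat \<gamma> - X)"
    and Q: "Q \<in> ambiguity_set \<rho> \<mu> \<Sigma>"
  shows "(\<integral>\<xi>. (\<xi> - \<mu>) \<bullet> (X *v (\<xi> - \<mu>)) \<partial>Q) \<le> dual_value \<rho> X (psd_sqrt \<Sigma>) \<gamma>"
proof -
  let ?P = "normal \<mu> \<Sigma>" and ?A = "psd_sqrt \<Sigma>"
  define V where "V = matrix_inv (mat \<gamma> - X)"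
  define W where "W = \<gamma>\<^sup>2 *\<^sub>R V - mat \<gamma>"
  obtain m S where QmS: "Q = normal m S" and W\<rho>: "wasserstein ?P Q \<le> \<rho>"
    using Q by (auto simp: ambiguity_set_def normal_family_def)
  have \<gamma>: "\<gamma> > 0" using pos_def_mat_diff_imp_pos[OF X K] .
  have symX: "transpose X = X" using X by (simp add: pos_def_def)
  have symW: "transpose W = W"
    using transpose_matrix_inv_pos_def[OF K]
    by (simp add: W_def V_def transpose_def vec_eq_iff mat_def)
  have Wz: "z \<bullet> (W *v z) = \<gamma>\<^sup>2 * (z \<bullet> (V *v z)) - \<gamma> * (norm z)\<^sup>2" for z
    by (simp add: W_def matrix_vector_mult_diff_rdistrib mat_vector_mult inner_diff_right
        power2_norm_eq_inner flip: scaleR_matrix_vector_assoc)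
  have WA: "?A \<bullet> (W ** ?A) = \<gamma>\<^sup>2 * (?A \<bullet> (V ** ?A)) - \<gamma> * (norm ?A)\<^sup>2"
    unfolding power2_norm_eq_inner
    by (simp add: inner_matrix_columns column_matrix_mult Wz power2_norm_eq_inner sum_subtractf sum_distrib_left)
  define k where "k = ?A \<bullet> (W ** ?A)"
  define E where "E = (\<integral>\<xi>. (\<xi> - \<mu>) \<bullet> (X *v (\<xi> - \<mu>)) \<partial>Q)"
  have "sqrt ((E - k) / \<gamma>) \<le> wasserstein ?P Q"
    unfolding wasserstein_def
  proof (rule cINF_greatest)
    show "couplings ?P Q \<noteq> {}"
      unfolding QmS normal_def using affine_coupling by blast
    fix M assume M: "M \<in> couplings ?P Q"
    have [measurable_cong]: "sets M = sets borel"
      and P: "distr M borel fst = ?P" and Q: "distr M borel snd = Q"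
      using M by (auto simp: couplings_def)
    have [measurable]: "fst \<in> borel_measurable (borel :: ((real^'n) \<times> (real^'n)) measure)"
      "snd \<in> borel_measurable (borel :: ((real^'n) \<times> (real^'n)) measure)"
      by (intro borel_measurable_continuous_onI continuous_intros)+
    have fst_M: "fst \<in> borel_measurable M" and snd_M: "snd \<in> borel_measurable M" by measurable
    have fst_int: "has_bochner_integral M (\<lambda>\<xi>. (fst \<xi> - \<mu>) \<bullet> (Z *v (fst \<xi> - \<mu>))) (?A \<bullet> (Z ** ?A))"
      if "transpose Z = Z" for Z :: "real^'n^'n"
      using normal_quadratic[OF that, of \<mu> \<Sigma> \<mu>] borel_measurable_quadratic fst_M
      unfolding P[symmetric] has_bochner_integral_iff
      by (simp add: integrable_distr_eq integral_distr)
    have snd_int: "integrable M (\<lambda>\<xi>. (snd \<xi> - \<mu>) \<bullet> (Z *v (snd \<xi> - \<mu>)))"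
      "(\<integral>\<xi>. (snd \<xi> - \<mu>) \<bullet> (Z *v (snd \<xi> - \<mu>)) \<partial>M) = (\<integral>\<xi>. (\<xi> - \<mu>) \<bullet> (Z *v (\<xi> - \<mu>)) \<partial>Q)"
      if "transpose Z = Z" for Z :: "real^'n^'n"
      using normal_quadratic[OF that, of m S \<mu>, folded QmS] borel_measurable_quadratic snd_M
      unfolding Q[symmetric] has_bochner_integral_iff
      by (simp_all add: integrable_distr_eq integral_distr)
    have cost: "integrable M (\<lambda>\<xi>. (norm (fst \<xi> - snd \<xi>))\<^sup>2)"
    proof (rule Bochner_Integration.integrable_bound)
      let ?f = "\<lambda>\<xi>. 2 * ((fst \<xi> - \<mu>) \<bullet> (mat 1 *v (fst \<xi> - \<mu>))) + 2 * ((snd \<xi> - \<mu>) \<bullet> (mat 1 *v (snd \<xi> - \<mu>)))"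
      show "integrable M ?f"
        using fst_int[of "mat 1"] snd_int(1)[of "mat 1"]
        by (intro Bochner_Integration.integrable_add integrable_mult_right)
          (simp_all add: has_bochner_integral_iff)
      have "(norm (x - y))\<^sup>2 \<le> 2 * (x \<bullet> x) + 2 * (y \<bullet> y)" for x y :: "real^'n"
      proof -
        have "2 * (x \<bullet> x) + 2 * (y \<bullet> y) - (x - y) \<bullet> (x - y) = (x + y) \<bullet> (x + y)"
          by (simp add: inner_diff_left inner_diff_right inner_add_left inner_add_right inner_commute)
        then show ?thesis unfolding power2_norm_eq_inner using inner_ge_zero[of "x + y"] by linarith
      qed
      from this[of "fst \<xi> - \<mu>" "snd \<xi> - \<mu>" for \<xi>]
      have le: "(norm (fst \<xi> - snd \<xi>))\<^sup>2 \<le> ?f \<xi>" for \<xi>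
        by (simp only: matrix_vector_mul_lid diff_diff_eq2 diff_add_cancel)
      show "AE \<xi> in M. norm ((norm (fst \<xi> - snd \<xi>))\<^sup>2) \<le> norm (?f \<xi>)"
      proof (rule AE_I2)
        fix \<xi>
        show "norm ((norm (fst \<xi> - snd \<xi>))\<^sup>2) \<le> norm (?f \<xi>)"
          using order_trans[OF le[of \<xi>] abs_ge_self] by (simp only: real_norm_def abs_power2)
      qed
    qed (measurable)
    have "E \<le> (\<integral>\<xi>. \<gamma> * (norm (fst \<xi> - snd \<xi>))\<^sup>2 + (fst \<xi> - \<mu>) \<bullet> (W *v (fst \<xi> - \<mu>)) \<partial>M)"
      unfolding E_def snd_int(2)[OF symX, symmetric]
    proof (intro integral_mono snd_int symX Bochner_Integration.integrable_add integrable_mult_right cost)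
      show "integrable M (\<lambda>\<xi>. (fst \<xi> - \<mu>) \<bullet> (W *v (fst \<xi> - \<mu>)))"
        using fst_int[OF symW] by (simp add: has_bochner_integral_iff)
      fix \<xi>
      let ?w = "snd \<xi> - \<mu>" and ?z = "fst \<xi> - \<mu>"
      have "norm (fst \<xi> - snd \<xi>) = norm (?w - ?z)" by (simp add: norm_minus_commute)
      moreover have "0 \<le> y \<bullet> ((mat \<gamma> - X) *v y)" for y
        using pos_def_imp_psd[OF K] by (simp add: psd_def)
      ultimately show "?w \<bullet> (X *v ?w) \<le> \<gamma> * (norm (fst \<xi> - snd \<xi>))\<^sup>2 + ?z \<bullet> (W *v ?z)"
        using penalized_quadratic_gap[OF K, of ?w ?z, folded V_def]
        unfolding Wz by (metis diff_ge_0_iff_ge)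
    qed
    also have "\<dots> = \<gamma> * (\<integral>\<xi>. (norm (fst \<xi> - snd \<xi>))\<^sup>2 \<partial>M) + k"
      using fst_int[OF symW] cost by (simp add: has_bochner_integral_iff k_def)
    finally have "(E - k) / \<gamma> \<le> (\<integral>\<xi>. (norm (fst \<xi> - snd \<xi>))\<^sup>2 \<partial>M)"
      using \<gamma> by (simp add: divide_le_eq mult.commute)
    then show "sqrt ((E - k) / \<gamma>) \<le> sqrt (\<integral>\<xi>. (norm (fst \<xi> - snd \<xi>))\<^sup>2 \<partial>M)"
      by (rule real_sqrt_le_mono)
  qed
  with W\<rho> have "sqrt ((E - k) / \<gamma>) \<le> \<rho>" by simp
  then have "(E - k) / \<gamma> \<le> \<rho>\<^sup>2" by (rule sqrt_le_D)
  then have "E \<le> \<gamma> * \<rho>\<^sup>2 + k" using \<gamma> by (simp add: divide_le_eq mult.commute)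
  then show ?thesis
    by (simp add: E_def k_def WA dual_value_def V_def algebra_simps)
qed

text \<open>The centre \<open>\<mu>\<close> of the loss is arbitrary here: the laws used have the nominal mean, and a loss
  centred elsewhere has an expectation at least as large.\<close>

lemma ball_max_le_worst_case:
  fixes X \<Sigma> :: "real^'n^'n"
  assumes \<rho>: "\<rho> > 0" and X: "pos_def X"
    and le: "\<And>Q. Q \<in> ambiguity_set \<rho> \<mu>h \<Sigma> \<Longrightarrow> (\<integral>\<xi>. (\<xi> - \<mu>) \<bullet> (X *v (\<xi> - \<mu>)) \<partial>Q) \<le> c"
  shows "ball_max \<rho> X (psd_sqrt \<Sigma>) \<le> c"
proof (rule ball_max_le_invertible[OF \<rho>])
  fix B :: "real^'n^'n" assume B: "invertible B" "B \<in> cball (psd_sqrt \<Sigma>) \<rho>"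
  let ?Q = "normal \<mu>h (B ** transpose B)"
  have "wasserstein (normal \<mu>h \<Sigma>) ?Q \<le> norm (psd_sqrt \<Sigma> - B)"
    unfolding distr_std_normal_invertible(1)[OF B(1), symmetric]
    unfolding normal_def by (rule wasserstein_affine_le)
  also have "\<dots> \<le> \<rho>" using B(2) by (simp add: dist_norm)
  finally have "?Q \<in> ambiguity_set \<rho> \<mu>h \<Sigma>"
    using distr_std_normal_invertible(2)[OF B(1)]
    by (auto simp: ambiguity_set_def normal_family_def)
  then have "(\<integral>\<xi>. (\<xi> - \<mu>) \<bullet> (X *v (\<xi> - \<mu>)) \<partial>?Q) \<le> c" by (rule le)
  then have "(\<mu>h - \<mu>) \<bullet> (X *v (\<mu>h - \<mu>)) + B \<bullet> (X ** B) \<le> c"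
    unfolding distr_std_normal_invertible(1)[OF B(1), symmetric]
    using affine_std_normal_quadratic[of X \<mu>h B \<mu>] X
    by (simp add: has_bochner_integral_iff pos_def_def)
  moreover have "0 \<le> (\<mu>h - \<mu>) \<bullet> (X *v (\<mu>h - \<mu>))"
    using pos_def_imp_psd[OF X] by (simp add: psd_def)
  ultimately show "B \<bullet> (X ** B) \<le> c" by linarith
qed

lemma dro_value_eq_ball_max:
  fixes \<X> :: "(real^'n^'n) set"
  assumes \<rho>: "\<rho> > 0" and \<X>: "\<X> \<subseteq> {X. pos_def X}"
  shows "dro_value \<rho> \<X> \<mu>h \<Sigma> = (INF X\<in>\<X>. ereal (- ln (det X) + ball_max \<rho> X (psd_sqrt \<Sigma>)))"
    (is "_ = ?R")
proof (rule antisym)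
  show "dro_value \<rho> \<X> \<mu>h \<Sigma> \<le> ?R"
  proof (rule INF_greatest)
    fix X assume X: "X \<in> \<X>"
    then have pX: "pos_def X" using \<X> by auto
    have "(SUP Q\<in>ambiguity_set \<rho> \<mu>h \<Sigma>. ereal (\<integral>\<xi>. (\<xi> - \<mu>h) \<bullet> (X *v (\<xi> - \<mu>h)) \<partial>Q))
        \<le> ereal (ball_max \<rho> X (psd_sqrt \<Sigma>))"
    proof (rule SUP_least)
      fix Q assume Q: "Q \<in> ambiguity_set \<rho> \<mu>h \<Sigma>"
      have "(\<integral>\<xi>. (\<xi> - \<mu>h) \<bullet> (X *v (\<xi> - \<mu>h)) \<partial>Q) \<le> ball_max \<rho> X (psd_sqrt \<Sigma>)"
      proof (rule field_le_epsilon)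
        fix e :: real assume "e > 0"
        then obtain \<gamma> where \<gamma>: "pos_def (mat \<gamma> - X)"
          "dual_value \<rho> X (psd_sqrt \<Sigma>) \<gamma> \<le> ball_max \<rho> X (psd_sqrt \<Sigma>) + e"
          using dual_value_approximates[OF \<rho> pX] by blast
        show "(\<integral>\<xi>. (\<xi> - \<mu>h) \<bullet> (X *v (\<xi> - \<mu>h)) \<partial>Q) \<le> ball_max \<rho> X (psd_sqrt \<Sigma>) + e"
          using ambiguity_weak_duality[OF \<rho> pX \<gamma>(1) Q] \<gamma>(2) by (rule order_trans)
      qed
      then show "ereal (\<integral>\<xi>. (\<xi> - \<mu>h) \<bullet> (X *v (\<xi> - \<mu>h)) \<partial>Q) \<le> ereal (ball_max \<rho> X (psd_sqrt \<Sigma>))"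
        by simp
    qed
    then have "ereal (- ln (det X))
        + (SUP Q\<in>ambiguity_set \<rho> \<mu>h \<Sigma>. ereal (\<integral>\<xi>. (\<xi> - \<mu>h) \<bullet> (X *v (\<xi> - \<mu>h)) \<partial>Q))
        \<le> ereal (- ln (det X) + ball_max \<rho> X (psd_sqrt \<Sigma>))"
      unfolding plus_ereal.simps(1)[symmetric] by (intro add_left_mono)
    then show "dro_value \<rho> \<X> \<mu>h \<Sigma> \<le> ereal (- ln (det X) + ball_max \<rho> X (psd_sqrt \<Sigma>))"
      unfolding dro_value_def using X by (intro INF_lower2[of "(\<mu>h, X)"]) auto
  qed
  show "?R \<le> dro_value \<rho> \<X> \<mu>h \<Sigma>"
    unfolding dro_value_def
  proof (rule INF_greatest, clarify)
    fix \<mu> X assume X: "X \<in> \<X>"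
    then have pX: "pos_def X" using \<X> by auto
    have "ereal (ball_max \<rho> X (psd_sqrt \<Sigma>))
        \<le> (SUP Q\<in>ambiguity_set \<rho> \<mu>h \<Sigma>. ereal (\<integral>\<xi>. (\<xi> - \<mu>) \<bullet> (X *v (\<xi> - \<mu>)) \<partial>Q))"
    proof (rule ereal_le_real)
      fix c assume "(SUP Q\<in>ambiguity_set \<rho> \<mu>h \<Sigma>. ereal (\<integral>\<xi>. (\<xi> - \<mu>) \<bullet> (X *v (\<xi> - \<mu>)) \<partial>Q)) \<le> ereal c"
      then show "ereal (ball_max \<rho> X (psd_sqrt \<Sigma>)) \<le> ereal c"
        using ball_max_le_worst_case[OF \<rho> pX, of \<mu>h \<Sigma> \<mu> c] by (simp add: SUP_le_iff)
    qed
    then have "ereal (- ln (det X) + ball_max \<rho> X (psd_sqrt \<Sigma>)) \<le> ereal (- ln (det X))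
        + (SUP Q\<in>ambiguity_set \<rho> \<mu>h \<Sigma>. ereal (\<integral>\<xi>. (\<xi> - \<mu>) \<bullet> (X *v (\<xi> - \<mu>)) \<partial>Q))"
      unfolding plus_ereal.simps(1)[symmetric] by (intro add_left_mono)
    then show "?R \<le> ereal (- ln (det X))
        + (SUP Q\<in>ambiguity_set \<rho> \<mu>h \<Sigma>. ereal (\<integral>\<xi>. (\<xi> - \<mu>) \<bullet> (X *v (\<xi> - \<mu>)) \<partial>Q))"
      by (rule INF_lower2[OF X])
  qed
qed

lemma dual_value_psd_sqrt:
  fixes X \<Sigma> :: "real^'n^'n"
  assumes \<Sigma>: "psd \<Sigma>" and K: "pos_def (mat \<gamma> - X)"
  shows "dual_value \<rho> X (psd_sqrt \<Sigma>) \<gamma>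
    = \<gamma> * (\<rho>\<^sup>2 - trace \<Sigma>) + \<gamma>\<^sup>2 * trace_inner (matrix_inv (mat \<gamma> - X)) \<Sigma>"
proof -
  let ?A = "psd_sqrt \<Sigma>" and ?V = "matrix_inv (mat \<gamma> - X)"
  have A: "transpose ?A = ?A" "?A ** ?A = \<Sigma>" using psd_sqrt[OF \<Sigma>] by (auto simp: psd_def)
  have "(norm ?A)\<^sup>2 = trace \<Sigma>" by (simp add: power2_norm_eq_inner inner_matrix_trace A)
  moreover have "?A \<bullet> (?V ** ?A) = trace_inner ?V \<Sigma>"
    unfolding inner_matrix_trace trace_inner_def A(1) transpose_matrix_inv_pos_def[OF K]
    by (subst trace_mul_sym) (simp add: A(2) flip: matrix_mul_assoc)
  ultimately show ?thesis by (simp add: dual_value_def)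
qed

lemma INF_ball_max_eq_INF_dual:
  fixes \<X> :: "(real^'n^'n) set"
  assumes \<rho>: "\<rho> > 0" and \<X>: "\<X> \<subseteq> {X. pos_def X}"
  shows "(INF X\<in>\<X>. ereal (- ln (det X) + ball_max \<rho> X A))
    = (INF (X, \<gamma>)\<in>{(X, \<gamma>). pos_def (mat \<gamma> - X) \<and> X \<in> \<X>}. ereal (- ln (det X) + dual_value \<rho> X A \<gamma>))"
    (is "?L = ?R")
proof (rule antisym)
  show "?L \<le> ?R"
  proof (rule INF_greatest, clarify)
    fix X \<gamma> assume X: "pos_def (mat \<gamma> - X)" "X \<in> \<X>"
    then show "?L \<le> ereal (- ln (det X) + dual_value \<rho> X A \<gamma>)"
      using \<X> dual_value_upper[OF \<rho> _ X(1), of A] by (intro INF_lower2[OF X(2)]) auto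
  qed
  show "?R \<le> ?L"
  proof (rule INF_greatest, rule ereal_le_epsilon2)
    fix X and e :: real assume X: "X \<in> \<X>" and e: "e > 0"
    then have "pos_def X" using \<X> by auto
    then obtain \<gamma> where g: "pos_def (mat \<gamma> - X)" "dual_value \<rho> X A \<gamma> \<le> ball_max \<rho> X A + e"
      using dual_value_approximates[OF \<rho> _ e] by blast
    have "?R \<le> ereal (- ln (det X) + dual_value \<rho> X A \<gamma>)"
      using X g(1) by (intro INF_lower2[of "(X, \<gamma>)"]) auto
    also have "\<dots> \<le> ereal (- ln (det X) + ball_max \<rho> X A) + ereal e" using g(2) by simp
    finally show "?R \<le> ereal (- ln (det X) + ball_max \<rho> X A) + ereal e" .
  qed
qed

section \<open>The semidefinite program\<close>

text \<open>A vector indexed by the sum type is a pair of vectors.\<close>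

lemma psd_block_matrix_iff:
  fixes A :: "real^'n^'n" and B :: "real^'m^'n" and D :: "real^'m^'m"
  assumes sym: "transpose A = A" "transpose D = D"
  shows "psd (block_matrix A B (transpose B) D)
    \<longleftrightarrow> (\<forall>x y. 0 \<le> x \<bullet> (A *v x) + 2 * (x \<bullet> (B *v y)) + y \<bullet> (D *v y))"
proof -
  let ?M = "block_matrix A B (transpose B) D"
  have ent: "A $ j $ i = A $ i $ j" "D $ l $ k = D $ k $ l" for i j k l
    using arg_cong[OF sym(1), of "\<lambda>M. M $ i $ j"] arg_cong[OF sym(2), of "\<lambda>M. M $ k $ l"]
    by (simp_all add: transpose_def)
  have tr: "transpose ?M = ?M"
    by (simp add: vec_eq_iff transpose_def block_matrix_def ent split: sum.split)
  have sum_plus: "(\<Sum>i\<in>UNIV. f i) = (\<Sum>i\<in>UNIV. f (Inl i)) + (\<Sum>j\<in>UNIV. f (Inr j))"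
    for f :: "'n + 'm \<Rightarrow> real"
    by (simp add: sum.Plus flip: UNIV_Plus_UNIV)
  have form: "u \<bullet> (?M *v u) = x \<bullet> (A *v x) + 2 * (x \<bullet> (B *v y)) + y \<bullet> (D *v y)"
    if u: "\<And>i. u $ Inl i = x $ i" "\<And>j. u $ Inr j = y $ j" for u x y
  proof -
    have "u \<bullet> (?M *v u) = x \<bullet> (A *v x) + x \<bullet> (B *v y) + (y \<bullet> (transpose B *v x) + y \<bullet> (D *v y))"
      by (simp add: inner_vec_def matrix_vector_mult_def sum_plus block_matrix_def u
          distrib_left sum.distrib transpose_def del: transpose_matrix_vector)
    moreover have "y \<bullet> (transpose B *v x) = x \<bullet> (B *v y)"
      by (simp add: dot_lmul_matrix inner_commute[of y])
    ultimately show ?thesis by simp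
  qed
  show ?thesis
  proof
    assume psd: "psd ?M"
    show "\<forall>x y. 0 \<le> x \<bullet> (A *v x) + 2 * (x \<bullet> (B *v y)) + y \<bullet> (D *v y)"
    proof (intro allI)
      fix x y
      define u :: "real^('n + 'm)" where "u = (\<chi> i. case i of Inl k \<Rightarrow> x $ k | Inr l \<Rightarrow> y $ l)"
      have "u \<bullet> (?M *v u) = x \<bullet> (A *v x) + 2 * (x \<bullet> (B *v y)) + y \<bullet> (D *v y)"
        by (rule form) (simp_all add: u_def)
      moreover have "0 \<le> u \<bullet> (?M *v u)" using psd by (simp only: psd_def)
      ultimately show "0 \<le> x \<bullet> (A *v x) + 2 * (x \<bullet> (B *v y)) + y \<bullet> (D *v y)" by simp
    qed
  next
    assume nonneg: "\<forall>x y. 0 \<le> x \<bullet> (A *v x) + 2 * (x \<bullet> (B *v y)) + y \<bullet> (D *v y)"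
    have "0 \<le> u \<bullet> (?M *v u)" for u
      using nonneg form[of u "\<chi> i. u $ Inl i" "\<chi> j. u $ Inr j"] by simp
    then show "psd ?M" using tr by (simp add: psd_def)
  qed
qed

lemma trace_eq_sum_axis:
  fixes Y :: "real^'n^'n"
  shows "trace Y = (\<Sum>i\<in>UNIV. axis i 1 \<bullet> (Y *v axis i 1))"
  by (simp add: trace_def inner_axis' matrix_vector_mul_component inner_axis)

lemma inner_conjugate_sum_axis:
  fixes A V :: "real^'n^'n"
  shows "A \<bullet> (V ** A) = (\<Sum>i\<in>UNIV. (A *v axis i 1) \<bullet> (V *v (A *v axis i 1)))"
  by (simp add: inner_matrix_columns column_matrix_mult matrix_vector_mult_basis)

text \<open>Minimizing the block form over its second argument leaves the form of the Schur complement, so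
  \<open>Y\<close> dominates \<open>\<gamma>\<^sup>2 *\<^sub>R (A ** matrix_inv K ** A)\<close>.\<close>

lemma schur_trace_lower_bound:
  fixes Y A K :: "real^'n^'n"
  assumes K: "pos_def K" and A: "transpose A = A" and Y: "psd Y"
    and block: "psd (block_matrix Y (\<gamma> *\<^sub>R A) (\<gamma> *\<^sub>R A) K)"
  shows "\<gamma>\<^sup>2 * (A \<bullet> (matrix_inv K ** A)) \<le> trace Y"
proof -
  have nonneg: "0 \<le> x \<bullet> (Y *v x) + 2 * (x \<bullet> ((\<gamma> *\<^sub>R A) *v y)) + y \<bullet> (K *v y)" for x y
    using block psd_block_matrix_iff[of Y K "\<gamma> *\<^sub>R A"] Y K A
    by (simp add: psd_def[of Y] pos_def_def transpose_scalar)
  have "\<gamma>\<^sup>2 * ((A *v x) \<bullet> (matrix_inv K *v (A *v x))) \<le> x \<bullet> (Y *v x)" for x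
  proof -
    define z where "z = \<gamma> *\<^sub>R (A *v x)"
    define v where "v = matrix_inv K *v z"
    have "v \<bullet> (K *v v) - 2 * (z \<bullet> v) + z \<bullet> v = 0"
      using complete_square[OF K, of v z] by (simp add: v_def)
    moreover have "x \<bullet> ((\<gamma> *\<^sub>R A) *v (- v)) = - (z \<bullet> v)"
      using inner_matrix_vector_symmetric[OF A, of x v]
      by (simp add: z_def vec.neg matrix_vector_mult_scaleR flip: scaleR_matrix_vector_assoc)
    moreover have "(- v) \<bullet> (K *v (- v)) = v \<bullet> (K *v v)" by (simp add: vec.neg)
    ultimately have "z \<bullet> v \<le> x \<bullet> (Y *v x)" using nonneg[of x "- v"] by linarith
    then show ?thesis
      by (simp add: v_def z_def matrix_vector_mult_scaleR power2_eq_square mult.assoc)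
  qed
  then show ?thesis
    unfolding trace_eq_sum_axis inner_conjugate_sum_axis sum_distrib_left by (intro sum_mono)
qed

lemma schur_trace_attained:
  fixes A K :: "real^'n^'n" and \<gamma> :: real
  assumes K: "pos_def K" and A: "transpose A = A"
  defines "Y \<equiv> \<gamma>\<^sup>2 *\<^sub>R (A ** matrix_inv K ** A)"
  shows "psd Y" and "psd (block_matrix Y (\<gamma> *\<^sub>R A) (\<gamma> *\<^sub>R A) K)"
    and "trace Y = \<gamma>\<^sup>2 * (A \<bullet> (matrix_inv K ** A))"
proof -
  let ?V = "matrix_inv K"
  have symY: "transpose Y = Y"
    by (simp add: Y_def transpose_scalar matrix_transpose_mul A transpose_matrix_inv_pos_def[OF K]
        matrix_mul_assoc)
  have form: "x \<bullet> (Y *v x) = \<gamma>\<^sup>2 * ((A *v x) \<bullet> (?V *v (A *v x)))" for x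
    using inner_matrix_vector_symmetric[OF A, of x]
    by (simp add: Y_def flip: scaleR_matrix_vector_assoc matrix_vector_mul_assoc)
  show "psd Y"
    using psd_matrix_inv[OF K] symY by (simp add: psd_def form)
  have "0 \<le> x \<bullet> (Y *v x) + 2 * (x \<bullet> ((\<gamma> *\<^sub>R A) *v y)) + y \<bullet> (K *v y)" for x y
  proof -
    define z where "z = \<gamma> *\<^sub>R (A *v x)"
    have "0 \<le> (- y) \<bullet> (K *v (- y)) - 2 * (z \<bullet> (- y)) + z \<bullet> (?V *v z)"
      using complete_square[OF K, of "- y" z] pos_def_imp_psd[OF K] by (simp add: psd_def)
    moreover have "(- y) \<bullet> (K *v (- y)) = y \<bullet> (K *v y)" by (simp add: vec.neg)
    moreover have "z \<bullet> (?V *v z) = x \<bullet> (Y *v x)"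
      by (simp add: form z_def matrix_vector_mult_scaleR power2_eq_square)
    moreover have "x \<bullet> ((\<gamma> *\<^sub>R A) *v y) = z \<bullet> y"
      using inner_matrix_vector_symmetric[OF A, of x y]
      by (simp add: z_def flip: scaleR_matrix_vector_assoc)
    ultimately show ?thesis by simp
  qed
  then show "psd (block_matrix Y (\<gamma> *\<^sub>R A) (\<gamma> *\<^sub>R A) K)"
    using psd_block_matrix_iff[of Y K "\<gamma> *\<^sub>R A"] symY K A
    by (simp add: pos_def_def transpose_scalar)
  show "trace Y = \<gamma>\<^sup>2 * (A \<bullet> (?V ** A))"
    unfolding trace_eq_sum_axis inner_conjugate_sum_axis sum_distrib_left form ..
qed

lemma INF_dual_eq_INF_sdp:
  fixes \<X> :: "(real^'n^'n) set"
  assumes \<X>: "\<X> \<subseteq> {X. pos_def X}" and \<Sigma>: "psd \<Sigma>"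
  shows "(INF (X, \<gamma>)\<in>{(X, \<gamma>). pos_def (mat \<gamma> - X) \<and> X \<in> \<X>}.
      ereal (- ln (det X) + dual_value \<rho> X (psd_sqrt \<Sigma>) \<gamma>))
    = (INF (X, Y, \<gamma>) \<in> {(X, Y, \<gamma>).
        block_matrix Y (\<gamma> *\<^sub>R psd_sqrt \<Sigma>) (\<gamma> *\<^sub>R psd_sqrt \<Sigma>) (mat \<gamma> - X) \<succeq> 0
          \<and> mat \<gamma> \<succ> X \<and> X \<succ> 0 \<and> Y \<succeq> 0 \<and> X \<in> \<X>}.
        ereal (- ln (det X) + \<gamma> * (\<rho>\<^sup>2 - trace \<Sigma>) + trace Y))"
    (is "?L = ?R")
proof -
  let ?A = "psd_sqrt \<Sigma>"
  have A: "transpose ?A = ?A" using psd_psd_sqrt[OF \<Sigma>] by (simp add: psd_def)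
  have nA: "(norm ?A)\<^sup>2 = trace \<Sigma>"
    by (simp add: power2_norm_eq_inner inner_matrix_trace A psd_sqrt_square[OF \<Sigma>])
  show ?thesis
  proof (rule antisym)
    show "?L \<le> ?R"
    proof (rule INF_greatest, clarify)
      fix X Y \<gamma>
      assume h: "block_matrix Y (\<gamma> *\<^sub>R ?A) (\<gamma> *\<^sub>R ?A) (mat \<gamma> - X) \<succeq> 0" "mat \<gamma> \<succ> X" "Y \<succeq> 0" "X \<in> \<X>"
      then have "\<gamma>\<^sup>2 * (?A \<bullet> (matrix_inv (mat \<gamma> - X) ** ?A)) \<le> trace Y"
        using A by (intro schur_trace_lower_bound) (auto simp: loewner_ge_def loewner_gt_def)
      then show "?L \<le> ereal (- ln (det X) + \<gamma> * (\<rho>\<^sup>2 - trace \<Sigma>) + trace Y)"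
        using h by (intro INF_lower2[of "(X, \<gamma>)"]) (auto simp: loewner_gt_def dual_value_def nA)
    qed
    show "?R \<le> ?L"
    proof (rule INF_greatest, clarify)
      fix X \<gamma> assume h: "pos_def (mat \<gamma> - X)" "X \<in> \<X>"
      let ?Y = "\<gamma>\<^sup>2 *\<^sub>R (?A ** matrix_inv (mat \<gamma> - X) ** ?A)"
      note Y = schur_trace_attained[OF h(1) A, of \<gamma>]
      show "?R \<le> ereal (- ln (det X) + dual_value \<rho> X ?A \<gamma>)"
        using h Y \<X>
        by (intro INF_lower2[of "(X, ?Y, \<gamma>)"])
          (auto simp: loewner_ge_def loewner_gt_def dual_value_def nA)
    qed
  qed
qed

section \<open>Continuity of the optimal value\<close>

text \<open>Every point of the ball around \<open>A'\<close> has the form \<open>(1 + t) *\<^sub>R B - t *\<^sub>R A\<close> with \<open>B\<close> in the ball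
  around \<open>A\<close>. The square root of the form is a seminorm, and it is at most the root of the maximum at
  both \<open>B\<close> and \<open>A\<close>. That the factor is independent of \<open>X\<close> is what continuity of the infimum over
  \<open>X\<close> requires.\<close>

lemma ball_max_perturb:
  fixes X A A' :: "real^'n^'n"
  assumes \<rho>: "\<rho> > 0" and X: "psd X"
  defines "t \<equiv> norm (A' - A) / \<rho>"
  shows "ball_max \<rho> X A' \<le> (1 + 2 * t)\<^sup>2 * ball_max \<rho> X A"
proof -
  define q where "q B = B \<bullet> (X ** B)" for B :: "real^'n^'n"
  have lin: "linear (\<lambda>B::real^'n^'n. X ** B)" by (rule linear_matrix_mult_left)
  have symX: "transpose X = X" using X by (simp add: psd_def)
  obtain B' where B': "B' \<in> cball A' \<rho>" "ball_max \<rho> X A' = q B'"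
    using ball_max_attained[OF \<rho>] unfolding q_def by metis
  have t: "t \<ge> 0" using \<rho> by (simp add: t_def)
  \<comment> \<open>\<open>B'\<close> has distance at most \<open>\<rho> * (1 + t)\<close> from \<open>A\<close>; shrink it towards \<open>A\<close> into the ball.\<close>
  define B where "B = A + (1 / (1 + t)) *\<^sub>R (B' - A)"
  have "norm (B' - A) \<le> norm (B' - A') + norm (A' - A)"
    using norm_triangle_ineq[of "B' - A'" "A' - A"] by simp
  also have "\<dots> \<le> \<rho> * (1 + t)"
    using B'(1) \<rho> by (simp add: dist_norm norm_minus_commute t_def distrib_left)
  finally have "B \<in> cball A \<rho>"
    using t by (simp add: B_def dist_norm divide_le_eq)
  then have qB: "q B \<le> ball_max \<rho> X A" unfolding q_def by (rule ball_max_upper[OF \<rho>])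
  have qA: "q A \<le> ball_max \<rho> X A" unfolding q_def using \<rho> by (intro ball_max_upper) auto
  have B'_eq: "B' = (1 + t) *\<^sub>R B - t *\<^sub>R A"
    using t by (simp add: B_def algebra_simps)
  have "(1 + 2 * t) * ((1 + t) * q B + t * q A) - q B' = (1 + t) * t * q (A + B)"
    using inner_matrix_mult_symmetric[OF symX, of A B]
    unfolding B'_eq q_def linear_diff[OF lin] linear_cmul[OF lin] linear_add[OF lin]
    by (simp add: inner_diff_left inner_diff_right inner_add_left inner_add_right inner_commute
        algebra_simps)
  moreover have "0 \<le> (1 + t) * t * q (A + B)"
    using t inner_matrix_mult_nonneg[OF X] by (simp add: q_def)
  ultimately have "q B' \<le> (1 + 2 * t) * ((1 + t) * q B + t * q A)" by linarith
  also have "\<dots> \<le> (1 + 2 * t) * ((1 + t) * ball_max \<rho> X A + t * ball_max \<rho> X A)"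
    using t qA qB by (intro mult_left_mono add_mono) auto
  finally show ?thesis by (simp add: B'(2) power2_eq_square algebra_simps)
qed

text \<open>Moving from \<open>A\<close> by a multiple \<open>D\<close> of the identity with norm \<open>\<rho>\<close>, one of the two directions increases
  the form by at least its value at \<open>D\<close>, by the parallelogram law.\<close>

lemma ball_max_ge_trace:
  fixes X A :: "real^'n^'n"
  assumes \<rho>: "\<rho> > 0" and X: "psd X"
  shows "\<rho>\<^sup>2 / real CARD('n) * trace X \<le> ball_max \<rho> X A"
proof -
  define q where "q B = B \<bullet> (X ** B)" for B :: "real^'n^'n"
  have lin: "linear (\<lambda>B::real^'n^'n. X ** B)" by (rule linear_matrix_mult_left)
  \<comment> \<open>The identity has Frobenius norm \<open>sqrt (real CARD('n))\<close>.\<close>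
  define D where "D = (\<rho> / sqrt (real CARD('n))) *\<^sub>R (mat 1 :: real^'n^'n)"
  have "(norm (mat 1 :: real^'n^'n))\<^sup>2 = real CARD('n)"
    unfolding power2_norm_eq_inner by (simp add: inner_matrix_trace trace_I)
  then have "norm (mat 1 :: real^'n^'n) = sqrt (real CARD('n))"
    by (metis norm_ge_zero real_sqrt_unique)
  then have nD: "norm D = \<rho>" using \<rho> by (simp add: D_def)
  have "q (A + D) \<le> ball_max \<rho> X A" "q (A - D) \<le> ball_max \<rho> X A"
    unfolding q_def using \<rho> nD by (auto intro!: ball_max_upper simp: dist_norm)
  moreover have "q (A + D) + q (A - D) = 2 * q A + 2 * q D"
    unfolding q_def linear_diff[OF lin] linear_add[OF lin]
    by (simp add: inner_diff_left inner_diff_right inner_add_left inner_add_right)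
  moreover have "q A \<ge> 0" unfolding q_def by (rule inner_matrix_mult_nonneg[OF X])
  moreover have "q D = \<rho>\<^sup>2 / real CARD('n) * trace X"
  proof -
    have "q D = (\<rho> / sqrt (real CARD('n)))\<^sup>2 * ((mat 1 :: real^'n^'n) \<bullet> X)"
      unfolding q_def D_def linear_cmul[OF lin]
      by (simp only: inner_scaleR_left inner_scaleR_right matrix_mul_rid power2_eq_square mult.assoc)
    also have "(mat 1 :: real^'n^'n) \<bullet> X = trace X" by (simp add: inner_matrix_trace)
    finally show ?thesis by (simp add: power_divide)
  qed
  ultimately show ?thesis by linarith
qed

lemma det_pos_def:
  fixes X :: "real^'n^'n"
  assumes "pos_def X"
  shows "det X > 0"
proof -
  have "det X = (det (psd_sqrt X))\<^sup>2"
    using arg_cong[OF psd_sqrt_square[OF pos_def_imp_psd[OF assms]], of det]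
    by (simp add: det_mul power2_eq_square)
  moreover have "det X \<noteq> 0" using invertible_pos_def[OF assms] by (simp add: invertible_det_nz)
  moreover have "0 \<le> (det (psd_sqrt X))\<^sup>2" by simp
  ultimately show ?thesis by linarith
qed

text \<open>The Leibniz expansion has \<open>fact CARD('n)\<close> terms, and no entry of a positive semidefinite matrix
  exceeds the trace in absolute value. A polynomial bound in the trace, however crude, is enough to
  control the logarithm of the determinant.\<close>

lemma det_le_trace_power:
  fixes X :: "real^'n^'n"
  assumes X: "psd X"
  shows "det X \<le> fact CARD('n) * trace X ^ CARD('n)"
proof -
  have ex: "(axis k 1 :: real^'n) \<bullet> (X *v axis l 1) = X $ k $ l" for k l
    by (simp add: inner_axis' matrix_vector_mul_component inner_axis)
  have diag: "X $ i $ i \<ge> 0" for i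
    using X unfolding psd_def ex[symmetric] by blast
  have entry: "\<bar>X $ i $ j\<bar> \<le> trace X" for i j
  proof -
    have "transpose X $ i $ j = X $ i $ j" using X by (simp add: psd_def)
    then have sym: "X $ j $ i = X $ i $ j" by (simp add: transpose_def)
    have "0 \<le> (axis i 1 + axis j 1) \<bullet> (X *v (axis i 1 + axis j 1))"
      "0 \<le> (axis i 1 - axis j 1) \<bullet> (X *v (axis i 1 - axis j 1))"
      using X by (auto simp: psd_def)
    then have "2 * \<bar>X $ i $ j\<bar> \<le> X $ i $ i + X $ j $ j"
      by (simp only: matrix_vector_right_distrib matrix_vector_mult_diff_distrib
          inner_add_left inner_add_right inner_diff_left inner_diff_right ex sym)
    moreover have dt: "X $ k $ k \<le> trace X" for k
      unfolding trace_def using diag by (intro member_le_sum) auto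
    ultimately show ?thesis using dt[of i] dt[of j] by linarith
  qed
  have "det X \<le> (\<Sum>p\<in>{p. p permutes (UNIV::'n set)}. trace X ^ CARD('n))"
    unfolding det_def
  proof (rule sum_mono)
    fix p :: "'n \<Rightarrow> 'n"
    have "of_int (sign p) * (\<Prod>i\<in>UNIV. X $ i $ p i) \<le> \<bar>of_int (sign p) * (\<Prod>i\<in>UNIV. X $ i $ p i)\<bar>"
      by (rule abs_ge_self)
    also have "\<dots> = (\<Prod>i\<in>UNIV. \<bar>X $ i $ p i\<bar>)"
      by (simp add: abs_mult abs_prod sign_def)
    also have "\<dots> \<le> (\<Prod>i\<in>(UNIV::'n set). trace X)"
      by (intro prod_mono) (auto simp: entry)
    finally show "of_int (sign p) * (\<Prod>i\<in>UNIV. X $ i $ p i) \<le> trace X ^ CARD('n)" by simp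
  qed
  then show ?thesis by (simp add: card_permutations[OF refl])
qed

text \<open>The logarithm of the trace is dominated, up to a constant, by any multiple of the trace; the slope \<open>s\<close> below is
  chosen to produce the factor one half. This bounds the objective from below and bounds
  \<open>ball_max \<rho> X A\<close> by twice the objective, up to a constant.\<close>

lemma ln_det_le_ball_max:
  fixes \<rho> :: real
  assumes \<rho>: "\<rho> > 0"
  obtains C where "\<And>X A :: real^'n^'n. pos_def X \<Longrightarrow> ln (det X) \<le> ball_max \<rho> X A / 2 + C"
proof -
  define n where "n = real CARD('n)"
  define s where "s = \<rho>\<^sup>2 / (2 * n\<^sup>2)"
  have n: "n > 0" by (simp add: n_def)
  have s: "s > 0" using \<rho> n by (simp add: s_def)
  have "ln (det X) \<le> ball_max \<rho> X A / 2 + (ln (fact CARD('n)) - n * (1 + ln s))"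
    if X: "pos_def X" for X A :: "real^'n^'n"
  proof -
    note psdX = pos_def_imp_psd[OF X]
    have det: "0 < det X" "det X \<le> fact CARD('n) * trace X ^ CARD('n)"
      using det_pos_def[OF X] det_le_trace_power[OF psdX] by auto
    have tr: "trace X > 0"
    proof -
      have "(mat 1 :: real^'n^'n) \<noteq> 0" by (simp add: mat_def vec_eq_iff)
      from inner_matrix_mult_pos[OF X this] show ?thesis by (simp add: inner_matrix_trace)
    qed
    have "ln (det X) \<le> ln (fact CARD('n) * trace X ^ CARD('n))"
      using det tr by (subst ln_le_cancel_iff) auto
    also have "\<dots> = ln (fact CARD('n)) + n * ln (trace X)"
      using tr by (simp add: ln_mult ln_realpow n_def)
    also have "ln (trace X) \<le> s * trace X - 1 - ln s"
      using ln_le_minus_one[of "s * trace X"] s tr by (simp add: ln_mult)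
    then have "n * ln (trace X) \<le> n * (s * trace X - 1 - ln s)"
      using n by (intro mult_left_mono) auto
    also have "\<dots> = (\<rho>\<^sup>2 / n * trace X) / 2 - n * (1 + ln s)"
      using n by (simp add: s_def power2_eq_square field_simps)
    also have "\<dots> \<le> ball_max \<rho> X A / 2 - n * (1 + ln s)"
      using ball_max_ge_trace[OF \<rho> psdX, of A] by (simp add: n_def)
    finally show ?thesis by simp
  qed
  then show thesis using that by blast
qed

text \<open>After adding a constant, each objective value is nonnegative and at least half of
  \<open>ball_max \<rho> X A\<close>, so the multiplicative perturbation bound for \<open>ball_max\<close> becomes one for the objective,
  and then for the infimum \<open>k\<close>. The factor \<open>h A A'\<close> is symmetric and tends to 1.\<close>

lemma continuous_on_INF_ball_max:
  fixes \<X> :: "(real^'n^'n) set"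
  assumes \<rho>: "\<rho> > 0" and \<X>: "\<X> \<subseteq> {X. pos_def X}"
  shows "continuous_on UNIV (\<lambda>A. INF X\<in>\<X>. ereal (- ln (det X) + ball_max \<rho> X A))"
proof (cases "\<X> = {}")
  case False
  obtain C where C: "\<And>X A :: real^'n^'n. pos_def X \<Longrightarrow> ln (det X) \<le> ball_max \<rho> X A / 2 + C"
    using ln_det_le_ball_max[OF \<rho>] by blast
  define g where "g X A = - ln (det X) + ball_max \<rho> X A + C" for X A :: "real^'n^'n"
  define k where "k A = (INF X\<in>\<X>. g X A)" for A
  have bm: "0 \<le> ball_max \<rho> X A" "ball_max \<rho> X A \<le> 2 * g X A" if "X \<in> \<X>" for X A
  proof -
    have X: "pos_def X" using that \<X> by auto
    have "0 \<le> A \<bullet> (X ** A)" by (rule inner_matrix_mult_nonneg[OF pos_def_imp_psd[OF X]])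
    also have "\<dots> \<le> ball_max \<rho> X A" using \<rho> by (intro ball_max_upper) auto
    finally show "0 \<le> ball_max \<rho> X A" .
    show "ball_max \<rho> X A \<le> 2 * g X A" using C[OF X, of A] by (simp add: g_def)
  qed
  have bdd: "bdd_below ((\<lambda>X. g X A) ` \<X>)" for A
    using bm by (intro bdd_belowI2[of _ 0]) (meson order_trans zero_le_mult_iff linorder_not_le zero_less_numeral)
  have k_le: "k A \<le> g X A" if "X \<in> \<X>" for X A
    unfolding k_def by (rule cINF_lower[OF bdd that])
  have k_ge: "c \<le> k A" if "\<And>X. X \<in> \<X> \<Longrightarrow> c \<le> g X A" for c A
    unfolding k_def by (rule cINF_greatest[OF False that])
  have INF_eq: "(INF X\<in>\<X>. ereal (- ln (det X) + ball_max \<rho> X A)) = ereal (k A - C)" for A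
  proof (rule antisym)
    show "ereal (k A - C) \<le> (INF X\<in>\<X>. ereal (- ln (det X) + ball_max \<rho> X A))"
    proof (rule INF_greatest)
      fix X assume "X \<in> \<X>"
      from k_le[OF this, of A] show "ereal (k A - C) \<le> ereal (- ln (det X) + ball_max \<rho> X A)"
        by (simp add: g_def)
    qed
    have le: "(INF X\<in>\<X>. ereal (- ln (det X) + ball_max \<rho> X A)) \<le> ereal (g X A - C)" if "X \<in> \<X>" for X
      using that by (intro INF_lower2[of X]) (auto simp: g_def)
    show "(INF X\<in>\<X>. ereal (- ln (det X) + ball_max \<rho> X A)) \<le> ereal (k A - C)"
    proof (cases "INF X\<in>\<X>. ereal (- ln (det X) + ball_max \<rho> X A)")
      case (real r)
      have "r + C \<le> k A" using le unfolding real by (intro k_ge) (simp add: algebra_simps)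
      then show ?thesis unfolding real by simp
    qed (use le False in auto)
  qed
  define h where "h A A' = 2 * (1 + 2 * (norm (A' - A) / \<rho>))\<^sup>2 - 1" for A A' :: "real^'n^'n"
  have h: "1 \<le> h A A'" for A A'
    using \<rho> power_mono[of 1 "1 + 2 * (norm (A' - A) / \<rho>)" 2] by (simp add: h_def)
  have k_growth: "k A' \<le> h A A' * k A" for A A'
  proof -
    have "k A' / h A A' \<le> k A"
    proof (rule k_ge)
      fix X assume X: "X \<in> \<X>"
      define s where "s = (1 + 2 * (norm (A' - A) / \<rho>))\<^sup>2"
      have s: "s \<ge> 1" using h[of A A'] by (simp add: h_def s_def)
      have "ball_max \<rho> X A' \<le> s * ball_max \<rho> X A"
        unfolding s_def using X \<X> by (intro ball_max_perturb[OF \<rho>] pos_def_imp_psd) auto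
      then have "g X A' \<le> g X A + (s - 1) * ball_max \<rho> X A"
        by (simp add: g_def algebra_simps)
      also have "\<dots> \<le> g X A + (s - 1) * (2 * g X A)"
        using s bm[OF X] by (intro add_left_mono mult_left_mono) auto
      also have "\<dots> = h A A' * g X A" by (simp add: h_def s_def algebra_simps)
      finally have "k A' \<le> h A A' * g X A" using k_le[OF X, of A'] by simp
      then show "k A' / h A A' \<le> g X A"
        using h[of A A'] by (simp add: divide_le_eq mult.commute)
    qed
    then show ?thesis using h[of A A'] by (simp add: divide_le_eq mult.commute)
  qed
  have "continuous_on UNIV k"
    unfolding continuous_on_def
  proof
    fix A
    have h_lim: "((\<lambda>A'. h A A') \<longlongrightarrow> 1) (at A)"
    proof -
      have "((\<lambda>A'. h A A') \<longlongrightarrow> 2 * (1 + 2 * (norm (A - A) / \<rho>))\<^sup>2 - 1) (at A)"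
        unfolding h_def by (intro tendsto_intros) (use \<rho> in auto)
      then show ?thesis by simp
    qed
    show "(k \<longlongrightarrow> k A) (at A)"
    proof (rule tendsto_sandwich)
      show "\<forall>\<^sub>F A' in at A. k A / h A A' \<le> k A'"
      proof (intro always_eventually allI)
        fix A'
        have "h A' A = h A A'" by (simp add: h_def norm_minus_commute)
        with k_growth[of A A'] h[of A A'] show "k A / h A A' \<le> k A'"
          by (simp add: divide_le_eq mult.commute)
      qed
      show "\<forall>\<^sub>F A' in at A. k A' \<le> h A A' * k A"
        using k_growth by (auto intro!: always_eventually)
      show "((\<lambda>A'. k A / h A A') \<longlongrightarrow> k A) (at A)"
        using tendsto_divide[OF tendsto_const h_lim, of "k A"] by simp
      show "((\<lambda>A'. h A A' * k A) \<longlongrightarrow> k A) (at A)"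
        using tendsto_mult[OF h_lim tendsto_const, of "k A"] by simp
    qed
  qed
  then show ?thesis
    unfolding INF_eq by (intro continuous_intros)
qed simp

section \<open>The reformulations\<close>

theorem theorem2p10:
  fixes \<rho> :: real and \<X> :: "(real^'n^'n) set"
  assumes "\<rho> > 0" and "\<X> \<subseteq> {X. pos_def X}"
  shows
    "(\<forall>\<mu>h \<Sigma>h. psd \<Sigma>h \<longrightarrow>
        dro_value \<rho> \<X> \<mu>h \<Sigma>h =
          (INF (X, \<gamma>) \<in> {(X, \<gamma>). mat \<gamma> \<succ> X \<and> X \<succ> 0 \<and> X \<in> \<X>}.
             ereal (- ln (det X) + \<gamma> * (\<rho>\<^sup>2 - trace \<Sigma>h)
                    + \<gamma>\<^sup>2 * trace_inner (matrix_inv (mat \<gamma> - X)) \<Sigma>h))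
      \<and> dro_value \<rho> \<X> \<mu>h \<Sigma>h =
          (INF (X, Y, \<gamma>) \<in> {(X, Y, \<gamma>).
               block_matrix Y (\<gamma> *\<^sub>R psd_sqrt \<Sigma>h) (\<gamma> *\<^sub>R psd_sqrt \<Sigma>h) (mat \<gamma> - X) \<succeq> 0
               \<and> mat \<gamma> \<succ> X \<and> X \<succ> 0 \<and> Y \<succeq> 0 \<and> X \<in> \<X>}.
             ereal (- ln (det X) + \<gamma> * (\<rho>\<^sup>2 - trace \<Sigma>h) + trace Y)))
     \<and> (\<forall>\<Sigma>h. psd \<Sigma>h \<longrightarrow>
          (\<forall>\<mu>1 \<mu>2. dro_value \<rho> \<X> \<mu>1 \<Sigma>h = dro_value \<rho> \<X> \<mu>2 \<Sigma>h))
     \<and> (\<forall>\<mu>h. continuous_on {\<Sigma>h. psd \<Sigma>h} (\<lambda>\<Sigma>h. dro_value \<rho> \<X> \<mu>h \<Sigma>h))"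
proof (intro conjI allI impI)
  note dro = dro_value_eq_ball_max[OF assms]
  fix \<mu>h :: "real^'n" and \<Sigma>h :: "real^'n^'n" assume \<Sigma>: "psd \<Sigma>h"
  have feasible: "{(X, \<gamma>). mat \<gamma> \<succ> X \<and> X \<succ> 0 \<and> X \<in> \<X>} = {(X, \<gamma>). pos_def (mat \<gamma> - X) \<and> X \<in> \<X>}"
    using assms(2) by (auto simp: loewner_gt_def)
  show "dro_value \<rho> \<X> \<mu>h \<Sigma>h =
      (INF (X, \<gamma>) \<in> {(X, \<gamma>). mat \<gamma> \<succ> X \<and> X \<succ> 0 \<and> X \<in> \<X>}.
         ereal (- ln (det X) + \<gamma> * (\<rho>\<^sup>2 - trace \<Sigma>h)
                + \<gamma>\<^sup>2 * trace_inner (matrix_inv (mat \<gamma> - X)) \<Sigma>h))"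
    unfolding dro INF_ball_max_eq_INF_dual[OF assms] feasible
    by (intro INF_cong) (auto simp: dual_value_psd_sqrt[OF \<Sigma>])
  show "dro_value \<rho> \<X> \<mu>h \<Sigma>h =
      (INF (X, Y, \<gamma>) \<in> {(X, Y, \<gamma>).
           block_matrix Y (\<gamma> *\<^sub>R psd_sqrt \<Sigma>h) (\<gamma> *\<^sub>R psd_sqrt \<Sigma>h) (mat \<gamma> - X) \<succeq> 0
           \<and> mat \<gamma> \<succ> X \<and> X \<succ> 0 \<and> Y \<succeq> 0 \<and> X \<in> \<X>}.
         ereal (- ln (det X) + \<gamma> * (\<rho>\<^sup>2 - trace \<Sigma>h) + trace Y))"
    unfolding dro INF_ball_max_eq_INF_dual[OF assms] by (rule INF_dual_eq_INF_sdp[OF assms(2) \<Sigma>])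
next
  fix \<Sigma>h and \<mu>1 \<mu>2 :: "real^'n"
  show "dro_value \<rho> \<X> \<mu>1 \<Sigma>h = dro_value \<rho> \<X> \<mu>2 \<Sigma>h"
    by (simp only: dro_value_eq_ball_max[OF assms])
next
  fix \<mu>h
  show "continuous_on {\<Sigma>h. psd \<Sigma>h} (\<lambda>\<Sigma>h. dro_value \<rho> \<X> \<mu>h \<Sigma>h)"
    unfolding dro_value_eq_ball_max[OF assms]
    by (rule continuous_on_compose2[OF continuous_on_INF_ball_max[OF assms] continuous_on_psd_sqrt]) auto
qed

end
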